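(* For every smooth compactly supported function $\psi:\mathbb{R}^3\to\mathbb{C}$ there is a constant $C_\psi$ (depending only on $\psi$) such that for all $\lambda>0$ and all $f\in L^4(\mathbb{R})$, $$\|T_\lambda^\psi f\|_{L^4(\mathbb{R}^2)}\le C_\psi\,\lambda^{-\frac38}\,\|f\|_{L^4(\mathbb{R})}.$$ Moreover this decay is sharp: if $\delta\in\mathbb{R}$ is such that for every smooth compactly supported $\psi$ there is a constant $C_\psi$ with $\|T_\lambda^\psi f\|_{L^4(\mathbb{R}^2)}\le C_\psi\lambda^{-\delta}\|f\|_{L^4(\mathbb{R})}$ for all $\lambda\ge 1$ and all $f\in L^4(\mathbb{R})$, then $\delta\le \frac38$.
   Context: For $\lambda>0$ and $\psi:\mathbb{R}^3\to\mathbb{C}$, the oscillatory integral operator $T_\lambda^\psi$ maps functions on $\mathbb{R}$ to functions on $\mathbb{R}^2$ by $$T_\lambda^\psi f(x,y)=\int_{\mathbb{R}}e^{i\lambda(x^2t+yt^2)}\psi(x,y,t)f(t)\,dt,\qquad (x,y)\in\mathbb{R}^2.$$ *)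

theory Defs
  imports "HOL-Analysis.Analysis"
begin

text \<open>
  \<open>C_k k f\<close> says that \<open>f\<close> is everywhere \<open>k\<close> times continuously differentiable: all iterated
  directional derivatives of order less than \<open>k\<close> are (Frechet) differentiable and those of order
  \<open>k\<close> are continuous. Directional derivatives are used because they keep the type of \<open>f\<close>.
\<close>
fun C_k :: "nat \<Rightarrow> ('a::euclidean_space \<Rightarrow> 'b::real_normed_vector) \<Rightarrow> bool" where
  "C_k 0 f \<longleftrightarrow> continuous_on UNIV f"
| "C_k (Suc k) f \<longleftrightarrow>
     (\<forall>x. f differentiable (at x)) \<and> (\<forall>v. C_k k (\<lambda>x. frechet_derivative f (at x) v))"

definition smooth :: "('a::euclidean_space \<Rightarrow> 'b::real_normed_vector) \<Rightarrow> bool" where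
  "smooth f \<longleftrightarrow> (\<forall>k. C_k k f)"

definition compactly_supported :: "('a::euclidean_space \<Rightarrow> 'b::real_normed_vector) \<Rightarrow> bool" where
  "compactly_supported f \<longleftrightarrow> compact (closure {x. f x \<noteq> 0})"

text \<open>
  Functions, not classes modulo null sets; measurability is Lebesgue measurability. The Bochner
  integral of a non-integrable function is \<open>0\<close>, so \<open>Lp_norm p f\<close> is meaningful
  only for \<open>f \<in> Lp_space p\<close>.
\<close>
definition Lp_space :: "real \<Rightarrow> ('a::euclidean_space \<Rightarrow> complex) set" where
  "Lp_space p = {f \<in> borel_measurable lebesgue. integrable lebesgue (\<lambda>x. norm (f x) powr p)}"

definition Lp_norm :: "real \<Rightarrow> ('a::euclidean_space \<Rightarrow> complex) \<Rightarrow> real" where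
  "Lp_norm p f = (\<integral>x. norm (f x) powr p \<partial>lebesgue) powr (1 / p)"

definition T_op ::
  "real \<Rightarrow> (real \<times> real \<times> real \<Rightarrow> complex) \<Rightarrow> (real \<Rightarrow> complex) \<Rightarrow> real \<times> real \<Rightarrow> complex" where
  "T_op lam \<psi> f =
     (\<lambda>(x, y). \<integral>t. exp (\<i> * complex_of_real (lam * (x\<^sup>2 * t + y * t\<^sup>2))) * \<psi> (x, y, t) * f t \<partial>lebesgue)"

text \<open>
  The inequality \<open>\<parallel>g\<parallel> \<le> B\<close> for the \<open>L\<^sup>p\<close> norm on \<open>[0, \<infinity>]\<close>, hence including that \<open>g\<close> has
  finite norm.
\<close>
definition Lp_norm_le :: "real \<Rightarrow> ('a::euclidean_space \<Rightarrow> complex) \<Rightarrow> real \<Rightarrow> bool" where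
  "Lp_norm_le p g B \<longleftrightarrow> g \<in> Lp_space p \<and> Lp_norm p g \<le> B"

end

(* The fourth power of the norm is that of the square of T f in L^2. After inserting a Gaussian weight
   in (x, y) it becomes a quadrilinear form in f whose kernel is the Fourier transform of the weight at
   lam U, lam V, with U = t1 + t2 - t3 - t4 and V = t1^2 + t2^2 - t3^2 - t4^2. It is bounded by
   |lam U|^(-1/2) exp (-(lam V)^2 / 2): the phase is quadratic in x and linear in y. By the
   symmetries of U and V, |f1 f2 f3 f4| may be replaced by a sum of fourth powers, and it remains to see
   that the integral of this bound over three of the four variables, taken over a bounded set, is O(lam^(-3/2)) uniformly
   in the fourth. The amplitude is removed by writing psi(x, y, t) as the integral of
   1[x' <= x] 1[y' <= y] (d_x d_y psi)(x', y', t) over (x', y').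

   For the sharpness take f = 1_[0,1] and a positive bump as amplitude: there is no cancellation for
   |x| <= lam^(-1/2) / 2 and |y| <= lam^(-1) / 2, a set of measure lam^(-3/2). *)
theory Submission
  imports Defs "HOL-Probability.Probability"
begin

section \<open>The quartic form\<close>

text \<open>The obstacle is a logarithmic divergence. On a line where V is affine with slope 2 * p,
  integrating the Gaussian in V gives a multiple of 1 / (lam * |p|), which just fails to be
  integrable at p = 0. On a bounded set a power eps of this singularity can be moved from p to the
  constant term c of V. Since c = U * (2 * a - U), where a is the fixed variable, the singularity of
  order 1/2 at U = 0 grows to 1/2 + eps, and one of order eps appears at U = 2 * a. The two points
  merge as a tends to 0, so uniformity in a requires 1/2 + 2 * eps < 1; the proof takes eps = 1/8.

  An amplitude depending jointly on (x, y) and t would spoil the explicit Gaussian Fourier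
  transforms. The representation by half-line indicators separates these variables: for each (x',
  y') the indicator leaves the t-integral and is bounded by 1, while the factor depending on t is
  absorbed into f.\<close>

lemma nn_integral_exp_neg_square_affine:
  fixes k b :: real
  assumes "k \<noteq> 0"
  shows "(\<integral>\<^sup>+x. ennreal (exp (- (k * x + b)\<^sup>2 / 2)) \<partial>lborel) = ennreal (sqrt (2 * pi) / \<bar>k\<bar>)"
proof -
  let ?g = "\<lambda>x::real. ennreal (exp (- x\<^sup>2 / 2))"
  have "(\<integral>\<^sup>+x. ?g x \<partial>lborel) = (\<integral>\<^sup>+x. ennreal (sqrt (2 * pi)) * ennreal (std_normal_density x) \<partial>lborel)"
    by (intro nn_integral_cong) (simp add: std_normal_density_def flip: ennreal_mult)
  also have "\<dots> = ennreal (sqrt (2 * pi)) * (\<integral>\<^sup>+x. ennreal (std_normal_density x) \<partial>lborel)"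
    by (intro nn_integral_cmult) simp
  also have "(\<integral>\<^sup>+x. ennreal (std_normal_density x) \<partial>lborel) = 1"
    by (subst nn_integral_eq_integral) auto
  finally have *: "(\<integral>\<^sup>+x. ?g x \<partial>lborel) = ennreal (sqrt (2 * pi))" by simp
  have "(\<integral>\<^sup>+x. ?g x \<partial>lborel) = ennreal \<bar>k\<bar> * (\<integral>\<^sup>+x. ?g (b + k * x) \<partial>lborel)"
    by (rule nn_integral_real_affine) (use assms in auto)
  then have "ennreal (1/\<bar>k\<bar>) * ennreal (sqrt (2 * pi)) = (ennreal (1/\<bar>k\<bar>) * ennreal \<bar>k\<bar>) * (\<integral>\<^sup>+x. ?g (b + k * x) \<partial>lborel)"
    using * by (simp add: mult.assoc)
  also have "ennreal (1/\<bar>k\<bar>) * ennreal \<bar>k\<bar> = 1"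
    using assms by (simp flip: ennreal_mult)
  finally show ?thesis by (simp add: add.commute flip: ennreal_mult)
qed

lemma nn_integral_abs_powr_bounded:
  fixes s M :: real
  assumes "s < 1" "0 \<le> M"
  shows "(\<integral>\<^sup>+x. ennreal (indicator {-M..M} x * \<bar>x\<bar> powr (-s)) \<partial>lborel) \<le> ennreal (2 * (M powr (1-s) / (1-s)))"
proof -
  let ?h = "\<lambda>x::real. ennreal (indicator {0..M} x * (x powr (-s)))"
  have "((\<lambda>x. x powr (-s)) has_integral (M powr (-s + 1) / (-s + 1))) {0..M}"
    by (rule has_integral_powr_from_0) (use assms in auto)
  then have "(\<integral>\<^sup>+x. ennreal (x powr (-s)) * indicator {0..M} x \<partial>lborel) = ennreal (M powr (-s + 1) / (-s + 1))"
    by (intro nn_integral_has_integral_lebesgue') (use assms in auto)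
  then have h: "(\<integral>\<^sup>+x. ?h x \<partial>lborel) = ennreal (M powr (1-s) / (1-s))"
    by (simp add: ennreal_mult' mult.commute ennreal_indicator)
  have h': "(\<integral>\<^sup>+x. ?h (-x) \<partial>lborel) = (\<integral>\<^sup>+x. ?h x \<partial>lborel)"
    using nn_integral_real_affine[of ?h "-1" 0] by simp
  have "(\<integral>\<^sup>+x. ennreal (indicator {-M..M} x * \<bar>x\<bar> powr (-s)) \<partial>lborel) \<le> (\<integral>\<^sup>+x. ?h x + ?h (-x) \<partial>lborel)"
    by (intro nn_integral_mono) (auto simp: indicator_def abs_if)
  also have "\<dots> = (\<integral>\<^sup>+x. ?h x \<partial>lborel) + (\<integral>\<^sup>+x. ?h (-x) \<partial>lborel)"
    by (intro nn_integral_add) auto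
  finally show ?thesis using h h' assms by (simp flip: ennreal_plus)
qed

text \<open>Over the whole line the integral is a multiple of 1 / (lam * |p|), not integrable in
  \<open>p\<close> near 0; the bound trades a power 1/8 of |p| for one of |c|. If |c| \<le> 4 * L *
  |p|, the factor (4 * L * |p| / |c|) powr (1/8) is at least 1 and may be inserted. Otherwise |2 * p
  * q| < |c| / 2 on the interval, so the affine function keeps distance |c| / 2 from 0 and the
  integrand is at most 2 / (lam * |c|). As |c| now exceeds 4 * L * |p|, most of 1 / |c| can be
  exchanged for a power of |p|.\<close>

lemma nn_integral_exp_neg_square_slab:
  fixes L lam p c :: real
  assumes "L > 0" "lam > 0" "p \<noteq> 0" "c \<noteq> 0"
  shows "(\<integral>\<^sup>+q. ennreal (indicator {-L..L} q * exp (- (lam * (2 * p * q + c))\<^sup>2 / 2)) \<partial>lborel)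
    \<le> ennreal (sqrt (2 * pi) * (4 * L) powr (1/8) / lam * \<bar>p\<bar> powr (-7/8) * \<bar>c\<bar> powr (-1/8))"
proof (cases "\<bar>c\<bar> \<le> 4 * L * \<bar>p\<bar>")
  case True
  have "(\<integral>\<^sup>+q. ennreal (indicator {-L..L} q * exp (- (lam * (2 * p * q + c))\<^sup>2 / 2)) \<partial>lborel)
      \<le> (\<integral>\<^sup>+q. ennreal (exp (- ((lam * 2 * p) * q + lam * c)\<^sup>2 / 2)) \<partial>lborel)"
    by (intro nn_integral_mono ennreal_leI) (auto simp: indicator_def algebra_simps)
  also have "\<dots> = ennreal (sqrt (2 * pi) / \<bar>lam * 2 * p\<bar>)"
    by (rule nn_integral_exp_neg_square_affine) (use assms in auto)
  also have "\<dots> \<le> ennreal (sqrt (2 * pi) * (4 * L) powr (1/8) / lam * \<bar>p\<bar> powr (-7/8) * \<bar>c\<bar> powr (-1/8))"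
  proof (rule ennreal_leI)
    have "\<bar>c\<bar> powr (1/8) \<le> (4 * L) powr (1/8) * \<bar>p\<bar> powr (1/8)"
      using powr_mono2[of "1/8" "\<bar>c\<bar>" "4 * L * \<bar>p\<bar>"] True assms by (simp add: powr_mult)
    then have "1 \<le> (4 * L) powr (1/8) * \<bar>p\<bar> powr (1/8) * \<bar>c\<bar> powr (-1/8)"
      using assms by (simp add: powr_minus field_simps)
    moreover have "\<bar>p\<bar> powr (1/8) = \<bar>p\<bar> * \<bar>p\<bar> powr (-7/8)"
      using assms powr_add[of "\<bar>p\<bar>" 1 "-7/8"] by simp
    ultimately have "1 / \<bar>p\<bar> \<le> (4 * L) powr (1/8) * \<bar>p\<bar> powr (-7/8) * \<bar>c\<bar> powr (-1/8)"
      using assms by (simp add: field_simps)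
    then have "sqrt (2 * pi) / lam * (1 / \<bar>p\<bar>) \<le> sqrt (2 * pi) / lam * ((4 * L) powr (1/8) * \<bar>p\<bar> powr (-7/8) * \<bar>c\<bar> powr (-1/8))"
      using assms by (intro mult_left_mono) auto
    moreover have "sqrt (2 * pi) / \<bar>lam * 2 * p\<bar> \<le> sqrt (2 * pi) / lam * (1 / \<bar>p\<bar>)"
      using assms by (simp add: field_simps abs_mult)
    ultimately show "sqrt (2 * pi) / \<bar>lam * 2 * p\<bar> \<le> sqrt (2 * pi) * (4 * L) powr (1/8) / lam * \<bar>p\<bar> powr (-7/8) * \<bar>c\<bar> powr (-1/8)"
      by (simp add: mult.assoc)
  qed
  finally show ?thesis .
next
  case False
  have b: "exp (- (lam * (2 * p * q + c))\<^sup>2 / 2) \<le> 2 / (lam * \<bar>c\<bar>)" if "q \<in> {-L..L}" for q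
  proof -
    have "\<bar>2 * p * q\<bar> \<le> 2 * \<bar>p\<bar> * L" using that by (auto simp: abs_mult intro!: mult_left_mono)
    moreover have "2 * (2 * \<bar>p\<bar> * L) < \<bar>c\<bar>" using False by (simp add: mult_ac)
    moreover have "\<bar>c\<bar> - \<bar>2 * p * q\<bar> \<le> \<bar>2 * p * q + c\<bar>" by arith
    ultimately have "\<bar>c\<bar> / 2 \<le> \<bar>2 * p * q + c\<bar>" by linarith
    then have "lam * (\<bar>c\<bar> / 2) \<le> \<bar>lam * (2 * p * q + c)\<bar>" using assms by (simp add: abs_mult)
    then have A: "(lam * (\<bar>c\<bar> / 2))\<^sup>2 \<le> (lam * (2 * p * q + c))\<^sup>2"
      using assms by (metis abs_ge_zero abs_le_square_iff abs_mult abs_of_pos half_gt_zero mult_pos_pos zero_less_abs_iff)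
    define w where "w = lam * \<bar>c\<bar>"
    have w: "w > 0" using assms by (simp add: w_def)
    \<comment> \<open>The square of \<open>w / 2 - 1\<close> is nonnegative. Together with exp s
      \<ge> 1 + s this uses only decay of order 1 / w of the Gaussian, which gives the same power of
      \<open>lam\<close> as the first case.\<close>
    have "w / 2 \<le> 1 + w\<^sup>2 / 8"
      using zero_le_power2[of "w/2 - 1"] by (simp add: power2_eq_square algebra_simps)
    also have "\<dots> \<le> 1 + (lam * (2 * p * q + c))\<^sup>2 / 2"
      using A by (simp add: w_def power2_eq_square algebra_simps)
    also have "\<dots> \<le> exp ((lam * (2 * p * q + c))\<^sup>2 / 2)" by (rule exp_ge_add_one_self)
    finally show ?thesis using w unfolding w_def[symmetric] by (simp add: exp_minus field_simps)
  qed
  have "(\<integral>\<^sup>+q. ennreal (indicator {-L..L} q * exp (- (lam * (2 * p * q + c))\<^sup>2 / 2)) \<partial>lborel)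
      \<le> (\<integral>\<^sup>+q. ennreal (2 / (lam * \<bar>c\<bar>)) * indicator {-L..L} q \<partial>lborel)"
    by (intro nn_integral_mono) (use b in \<open>auto simp: indicator_def intro!: ennreal_leI\<close>)
  also have "\<dots> = ennreal (4 * L / (lam * \<bar>c\<bar>))"
    using assms by (simp add: nn_integral_cmult_indicator flip: ennreal_mult)
  also have "\<dots> \<le> ennreal (sqrt (2 * pi) * (4 * L) powr (1/8) / lam * \<bar>p\<bar> powr (-7/8) * \<bar>c\<bar> powr (-1/8))"
  proof (rule ennreal_leI)
    have "(4 * L * \<bar>p\<bar>) powr (7/8) \<le> \<bar>c\<bar> powr (7/8)"
      using False assms by (intro powr_mono2) auto
    moreover have "\<bar>c\<bar> powr (7/8) = \<bar>c\<bar> * \<bar>c\<bar> powr (-1/8)"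
      using assms powr_add[of "\<bar>c\<bar>" 1 "-1/8"] by simp
    ultimately have "(4 * L) powr (7/8) * \<bar>p\<bar> powr (7/8) \<le> \<bar>c\<bar> * \<bar>c\<bar> powr (-1/8)"
      using assms by (simp add: powr_mult)
    then have "(4 * L) powr (7/8) \<le> \<bar>c\<bar> * \<bar>c\<bar> powr (-1/8) * \<bar>p\<bar> powr (-7/8)"
      using assms by (simp add: powr_minus field_simps)
    then have "(4 * L) powr (1/8) * (4 * L) powr (7/8) \<le> (4 * L) powr (1/8) * (\<bar>c\<bar> * \<bar>c\<bar> powr (-1/8) * \<bar>p\<bar> powr (-7/8))"
      by (intro mult_left_mono) auto
    also have "(4 * L) powr (1/8) * (4 * L) powr (7/8) = 4 * L"
      using assms by (simp flip: powr_add)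
    finally have "4 * L / \<bar>c\<bar> \<le> 1 * ((4 * L) powr (1/8) * \<bar>p\<bar> powr (-7/8) * \<bar>c\<bar> powr (-1/8))"
      using assms by (simp add: field_simps)
    also have "\<dots> \<le> sqrt (2 * pi) * ((4 * L) powr (1/8) * \<bar>p\<bar> powr (-7/8) * \<bar>c\<bar> powr (-1/8))"
      using pi_gt3 by (intro mult_right_mono) auto
    finally show "4 * L / (lam * \<bar>c\<bar>) \<le> sqrt (2 * pi) * (4 * L) powr (1/8) / lam * \<bar>p\<bar> powr (-7/8) * \<bar>c\<bar> powr (-1/8)"
      using assms by (simp add: field_simps)
  qed
  finally show ?thesis .
qed

text \<open>
  Up to the factor \<open>lam powr (-1/2)\<close>, a bound for the Gaussian average of the product of the phases of four
  functions: the first factor comes from \<open>x\<close>, the second from \<open>y\<close>. The value \<open>\<infinity>\<close> replaces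
  \<open>0 powr (-1/2)\<close>, which is \<open>0\<close> in HOL.
\<close>
definition quad_kernel :: "real \<Rightarrow> real \<Rightarrow> real \<Rightarrow> real \<Rightarrow> real \<Rightarrow> ennreal" where
  "quad_kernel lam t1 t2 t3 t4 =
     (if t1 + t2 - t3 - t4 = 0 then \<infinity> else ennreal (\<bar>t1 + t2 - t3 - t4\<bar> powr (-1/2))) *
     ennreal (exp (- (lam * (t1\<^sup>2 + t2\<^sup>2 - t3\<^sup>2 - t4\<^sup>2))\<^sup>2 / 2))"

lemma measurable_quad_kernel [measurable]:
  assumes [measurable]: "a \<in> borel_measurable M" "b \<in> borel_measurable M"
    "c \<in> borel_measurable M" "d \<in> borel_measurable M"
  shows "(\<lambda>x. quad_kernel lam (a x) (b x) (c x) (d x)) \<in> borel_measurable M"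
  unfolding quad_kernel_def by measurable

text \<open>Both factors are largest at the smaller argument. This decouples the singularities at U
  = 0 and U = 2 * a, which would otherwise have to be integrated jointly; the total exponent 3/4
  stays below 1, so the bound survives when they coincide.\<close>

lemma powr_mult_le_add_powr:
  fixes x y :: real
  assumes "x > 0" "y > 0"
  shows "x powr (-5/8) * y powr (-1/8) \<le> x powr (-3/4) + y powr (-3/4)"
proof -
  define m where "m = min x y"
  have m: "m > 0" using assms by (simp add: m_def)
  have "x powr (-5/8) * y powr (-1/8) \<le> m powr (-5/8) * m powr (-1/8)"
    by (intro mult_mono powr_mono2') (use m in \<open>auto simp: m_def\<close>)
  also have "\<dots> = m powr (-3/4)" by (simp flip: powr_add)
  also have "\<dots> \<le> x powr (-3/4) + y powr (-3/4)" by (simp add: m_def min_def)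
  finally show ?thesis .
qed

text \<open>
  With \<open>p = t2 - t4\<close>, \<open>q = t2 - t3\<close> and \<open>U = a + t2 - t3 - t4\<close> one has
  \<open>a\<^sup>2 + t2\<^sup>2 - t3\<^sup>2 - t4\<^sup>2 = 2 p q + U (2 a - U)\<close>, which is affine in \<open>q\<close> for fixed \<open>p\<close> and \<open>U\<close>.
\<close>
lemma nn_integral_quad_kernel_slab:
  fixes R lam a t p :: real
  assumes R: "R > 0" and lam: "lam > 0" and a: "a \<in> {-R..R}"
    and p: "p \<noteq> 0" and u: "a + p - t \<noteq> 0" and v: "a + t - p \<noteq> 0"
  defines "I \<equiv> indicator {-R..R} :: real \<Rightarrow> ennreal"
  shows "(\<integral>\<^sup>+q. I t * I (t + q) * I (t + q - p) * quad_kernel lam a (t + q) t (t + q - p) \<partial>lborel)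
    \<le> ennreal (sqrt (2 * pi) * (8 * R) powr (1/8) / lam) *
       (ennreal (indicator {-(2*R)..2*R} p * \<bar>p\<bar> powr (-(7/8))) *
        (ennreal (indicator {-(6*R)..6*R} (a + p - t) * \<bar>a + p - t\<bar> powr (-(3/4))) +
         ennreal (indicator {-(6*R)..6*R} (a + t - p) * \<bar>a + t - p\<bar> powr (-(3/4)))))"
    (is "_ \<le> ?rhs")
proof (cases "t \<in> {-R..R} \<and> p \<in> {-(2*R)..2*R}")
  case False
  \<comment> \<open>If \<open>t + q\<close> and \<open>t + q - p\<close> both lie in
    \<open>{-R..R}\<close>, then |p| \<le> 2 * R.\<close>
  then have "I t * I (t + q) * I (t + q - p) = 0" for q
    using R by (auto simp: I_def indicator_def)
  then show ?thesis by (simp only: mult_zero_left nn_integral_const zero_le)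
next
  case True
  define U where "U = a + p - t"
  define c where "c = U * (2 * a - U)"
  have U2: "2 * a - U = a + t - p" by (simp add: U_def)
  have c: "c \<noteq> 0" using u v unfolding c_def U2 by (simp add: U_def)
  have UR: "U \<in> {-(6*R)..6*R}" "a + t - p \<in> {-(6*R)..6*R}" using True a R by (auto simp: U_def)
  have Vq: "a\<^sup>2 + (t + q)\<^sup>2 - t\<^sup>2 - (t + q - p)\<^sup>2 = 2 * p * q + c" for q
    by (simp add: c_def U_def power2_eq_square algebra_simps)
  have Uq: "a + (t + q) - t - (t + q - p) = U" for q by (simp add: U_def)
  have U0: "U \<noteq> 0" using u by (simp add: U_def)
  have k: "quad_kernel lam a (t + q) t (t + q - p)
      = ennreal (\<bar>U\<bar> powr (-1/2)) * ennreal (exp (- (lam * (2 * p * q + c))\<^sup>2 / 2))" for q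
    unfolding quad_kernel_def Uq Vq using U0 by simp
  have "(\<integral>\<^sup>+q. I t * I (t + q) * I (t + q - p) * quad_kernel lam a (t + q) t (t + q - p) \<partial>lborel)
     \<le> (\<integral>\<^sup>+q. ennreal (\<bar>U\<bar> powr (-1/2)) * ennreal (indicator {-(2*R)..2*R} q * exp (- (lam * (2 * p * q + c))\<^sup>2 / 2)) \<partial>lborel)"
    \<comment> \<open>Since \<open>t\<close> and \<open>t + q\<close> lie in \<open>{-R..R}\<close>,
      |q| \<le> 2 * R. The slab estimate therefore applies with L = 2 * R, whence the factor 8 *
      R.\<close>
    unfolding k using True R by (intro nn_integral_mono) (auto simp: I_def indicator_def)
  also have "\<dots> = ennreal (\<bar>U\<bar> powr (-1/2)) * (\<integral>\<^sup>+q. ennreal (indicator {-(2*R)..2*R} q * exp (- (lam * (2 * p * q + c))\<^sup>2 / 2)) \<partial>lborel)"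
    by (intro nn_integral_cmult) measurable
  also have "\<dots> \<le> ennreal (\<bar>U\<bar> powr (-1/2)) * ennreal (sqrt (2 * pi) * (4 * (2*R)) powr (1/8) / lam * \<bar>p\<bar> powr (-7/8) * \<bar>c\<bar> powr (-1/8))"
    by (intro mult_left_mono nn_integral_exp_neg_square_slab) (use R lam p c in auto)
  also have "\<dots> = ennreal (sqrt (2 * pi) * (8 * R) powr (1/8) / lam * \<bar>p\<bar> powr (-7/8) * (\<bar>U\<bar> powr (-1/2) * \<bar>c\<bar> powr (-1/8)))"
    using lam by (simp add: mult_ac flip: ennreal_mult)
  \<comment> \<open>Half a power of |U| from the \<open>x\<close> integral and an eighth from
    \<open>c\<close> combine to 5/8.\<close>
  also have "\<bar>U\<bar> powr (-1/2) * \<bar>c\<bar> powr (-1/8) = \<bar>U\<bar> powr (-5/8) * \<bar>a + t - p\<bar> powr (-1/8)"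
    unfolding c_def U2 by (simp add: abs_mult powr_mult mult.assoc[symmetric] flip: powr_add)
  also have "ennreal (sqrt (2 * pi) * (8 * R) powr (1/8) / lam * \<bar>p\<bar> powr (-7/8) * (\<bar>U\<bar> powr (-5/8) * \<bar>a + t - p\<bar> powr (-1/8)))
    \<le> ennreal (sqrt (2 * pi) * (8 * R) powr (1/8) / lam * \<bar>p\<bar> powr (-7/8) * (\<bar>U\<bar> powr (-3/4) + \<bar>a + t - p\<bar> powr (-3/4)))"
    by (intro ennreal_leI mult_left_mono powr_mult_le_add_powr) (use lam U0 v in auto)
  also have "\<dots> = ?rhs"
    using True UR lam unfolding U_def by (simp add: mult.assoc flip: ennreal_mult ennreal_plus)
  finally show ?thesis .
qed

text \<open>For each \<open>t3\<close> the pair \<open>t2\<close>, \<open>t4\<close> is replaced by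
  q = t2 - t3 and p = t2 - t4, and \<open>q\<close> is integrated first, against the Gaussian. Next
  comes \<open>t3\<close>, before \<open>p\<close>: it enters only through translates and
  reflections of \<open>H\<close>, whose integral depends neither on \<open>a\<close> nor on
  \<open>p\<close>. This gives the uniformity in \<open>a\<close>.\<close>

lemma nn_integral_quad_kernel_bounded:
  fixes R :: real
  assumes R: "R > 0"
  defines "I \<equiv> indicator {-R..R} :: real \<Rightarrow> ennreal"
  shows "\<exists>C\<ge>0. \<forall>lam>0. \<forall>a\<in>{-R..R}.
      (\<integral>\<^sup>+t3. \<integral>\<^sup>+t2. \<integral>\<^sup>+t4. I t3 * I t2 * I t4 * quad_kernel lam a t2 t3 t4 \<partial>lborel \<partial>lborel \<partial>lborel) \<le> ennreal (C / lam)"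
proof -
  define K where "K = sqrt (2 * pi) * (8 * R) powr (1/8)"
  define A where "A = 2 * ((2*R) powr (1-7/8) / (1-7/8))"
  define B where "B = 2 * ((6*R) powr (1-3/4) / (1-3/4))"
  have nn: "K \<ge> 0" "A \<ge> 0" "B \<ge> 0" by (auto simp: K_def A_def B_def)
  define P where "P p = ennreal (indicator {-(2*R)..2*R} p * \<bar>p\<bar> powr (-(7/8)))" for p :: real
  define H where "H p = ennreal (indicator {-(6*R)..6*R} p * \<bar>p\<bar> powr (-(3/4)))" for p :: real
  have [measurable]: "P \<in> borel_measurable borel" "H \<in> borel_measurable borel"
    unfolding P_def[abs_def] H_def[abs_def] by measurable
  have [measurable]: "I \<in> borel_measurable borel" unfolding I_def by measurable
  have PA: "(\<integral>\<^sup>+p. P p \<partial>lborel) \<le> ennreal A"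
    unfolding P_def A_def by (rule nn_integral_abs_powr_bounded) (use R in auto)
  have HB: "(\<integral>\<^sup>+p. H p \<partial>lborel) \<le> ennreal B"
    unfolding H_def B_def by (rule nn_integral_abs_powr_bounded) (use R in auto)
  have "(\<integral>\<^sup>+t3. \<integral>\<^sup>+t2. \<integral>\<^sup>+t4. I t3 * I t2 * I t4 * quad_kernel lam a t2 t3 t4 \<partial>lborel \<partial>lborel \<partial>lborel) \<le> ennreal (K * A * (2 * B) / lam)"
    if lam: "lam > 0" and a: "a \<in> {-R..R}" for lam a
  proof -
    have 1: "(\<integral>\<^sup>+t2. \<integral>\<^sup>+t4. I t3 * I t2 * I t4 * quad_kernel lam a t2 t3 t4 \<partial>lborel \<partial>lborel)
        \<le> (\<integral>\<^sup>+p. ennreal (K / lam) * (P p * (H (a + p - t3) + H (a + t3 - p))) \<partial>lborel)" for t3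
    proof -
      let ?f = "\<lambda>t2 t4. I t3 * I t2 * I t4 * quad_kernel lam a t2 t3 t4"
      have "(\<integral>\<^sup>+t2. \<integral>\<^sup>+t4. ?f t2 t4 \<partial>lborel \<partial>lborel) = (\<integral>\<^sup>+t2. \<integral>\<^sup>+p. ?f t2 (t2 - p) \<partial>lborel \<partial>lborel)"
      proof (rule nn_integral_cong)
        fix t2 :: real show "(\<integral>\<^sup>+t4. ?f t2 t4 \<partial>lborel) = (\<integral>\<^sup>+p. ?f t2 (t2 - p) \<partial>lborel)"
          using nn_integral_real_affine[of "?f t2" "-1" t2] by simp
      qed
      also have "\<dots> = (\<integral>\<^sup>+p. \<integral>\<^sup>+t2. ?f t2 (t2 - p) \<partial>lborel \<partial>lborel)"
        by (intro lborel_pair.Fubini') measurable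
      also have "\<dots> = (\<integral>\<^sup>+p. \<integral>\<^sup>+q. ?f (t3 + q) (t3 + q - p) \<partial>lborel \<partial>lborel)"
      proof (rule nn_integral_cong)
        fix p :: real show "(\<integral>\<^sup>+t2. ?f t2 (t2 - p) \<partial>lborel) = (\<integral>\<^sup>+q. ?f (t3 + q) (t3 + q - p) \<partial>lborel)"
          using nn_integral_real_affine[of "\<lambda>t2. ?f t2 (t2 - p)" 1 t3] by simp
      qed
      also have "\<dots> \<le> (\<integral>\<^sup>+p. ennreal (K / lam) * (P p * (H (a + p - t3) + H (a + t3 - p))) \<partial>lborel)"
      proof (rule nn_integral_mono_AE)
        \<comment> \<open>The three excluded values are p = 0, U = 0 and U = 2 * a, where the
          singular factors of the slab bound are not defined.\<close>
        have "AE p in lborel. p \<noteq> 0" "AE p in lborel. p \<noteq> t3 - a" "AE p in lborel. p \<noteq> a + t3"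
          by (rule AE_lborel_singleton)+
        then show "AE p in lborel. (\<integral>\<^sup>+q. ?f (t3 + q) (t3 + q - p) \<partial>lborel) \<le> ennreal (K / lam) * (P p * (H (a + p - t3) + H (a + t3 - p)))"
        proof eventually_elim
          case (elim p)
          show ?case
            unfolding K_def P_def H_def I_def
            by (rule nn_integral_quad_kernel_slab) (use elim R lam a in auto)
        qed
      qed
      finally show ?thesis .
    qed
    have h1: "(\<integral>\<^sup>+t. H (a + p - t) \<partial>lborel) \<le> ennreal B" for p
      using nn_integral_real_affine[of H "-1" "a + p"] HB by simp
    have h2: "(\<integral>\<^sup>+t. H (a + t - p) \<partial>lborel) \<le> ennreal B" for p
      using nn_integral_real_affine[of H "1" "a - p"] HB by (simp add: algebra_simps)
    have "(\<integral>\<^sup>+t3. \<integral>\<^sup>+t2. \<integral>\<^sup>+t4. I t3 * I t2 * I t4 * quad_kernel lam a t2 t3 t4 \<partial>lborel \<partial>lborel \<partial>lborel)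
       \<le> (\<integral>\<^sup>+t. \<integral>\<^sup>+p. ennreal (K / lam) * (P p * (H (a + p - t) + H (a + t - p))) \<partial>lborel \<partial>lborel)"
      by (intro nn_integral_mono 1)
    also have "\<dots> = (\<integral>\<^sup>+p. \<integral>\<^sup>+t. ennreal (K / lam) * (P p * (H (a + p - t) + H (a + t - p))) \<partial>lborel \<partial>lborel)"
      by (intro lborel_pair.Fubini') measurable
    also have "\<dots> = (\<integral>\<^sup>+p. ennreal (K / lam) * (P p * ((\<integral>\<^sup>+t. H (a + p - t) \<partial>lborel) + (\<integral>\<^sup>+t. H (a + t - p) \<partial>lborel))) \<partial>lborel)"
      by (simp add: nn_integral_cmult nn_integral_add)
    also have "\<dots> \<le> (\<integral>\<^sup>+p. ennreal (K / lam) * (P p * (ennreal B + ennreal B)) \<partial>lborel)"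
      by (intro nn_integral_mono mult_left_mono add_mono h1 h2) auto
    also have "\<dots> = ennreal (K / lam) * ((\<integral>\<^sup>+p. P p \<partial>lborel) * (ennreal B + ennreal B))"
      by (simp add: nn_integral_cmult nn_integral_multc)
    also have "\<dots> \<le> ennreal (K / lam) * (ennreal A * (ennreal B + ennreal B))"
      by (intro mult_left_mono mult_right_mono PA) auto
    also have "\<dots> = ennreal (K * A * (2 * B) / lam)"
      using nn lam by (simp add: mult_ac flip: ennreal_mult ennreal_plus)
    finally show ?thesis .
  qed
  then show ?thesis using nn by (intro exI[of _ "K * A * (2 * B)"]) auto
qed

section \<open>Symmetrization of the quartic form\<close>

lemma quad_kernel_swap12: "quad_kernel lam b a c d = quad_kernel lam a b c d"
  unfolding quad_kernel_def by (simp add: add.commute)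

lemma quad_kernel_swap_pairs: "quad_kernel lam c d a b = quad_kernel lam a b c d"
proof -
  have 1: "c + d - a - b = - (a + b - c - d)" "c\<^sup>2 + d\<^sup>2 - a\<^sup>2 - b\<^sup>2 = - (a\<^sup>2 + b\<^sup>2 - c\<^sup>2 - d\<^sup>2)" by simp_all
  show ?thesis unfolding quad_kernel_def 1 mult_minus_right power2_minus abs_minus neg_equal_0_iff_equal ..
qed

text \<open>The product is at most the square of its larger factor. This argument also covers
  infinite values, for which the square of a difference makes no sense.\<close>

lemma ennreal_mult_le_add_squares:
  fixes a b :: ennreal shows "a * b \<le> a\<^sup>2 + b\<^sup>2"
proof (cases "a \<le> b")
  case True
  then have "a * b \<le> b\<^sup>2" by (simp add: power2_eq_square mult_right_mono)
  then show ?thesis by (simp add: add_increasing)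
next
  case False
  then have "a * b \<le> a\<^sup>2" by (simp add: power2_eq_square mult_left_mono)
  then show ?thesis by (simp add: add_increasing2)
qed

text \<open>A Schur test in two rounds: first the pairs (t1, t2) and (t3, t4) are separated, then
  the two entries of one pair. In each round the two resulting terms agree after renaming variables,
  by an invariance of \<open>quad_kernel\<close>, so each round costs a factor 2. What remains is
  g^4 against the kernel integrated over the other three variables. The variables are grouped as
  \<open>u\<close> and \<open>v\<close> because the form arises from the square of an integral over
  pairs.\<close>

lemma quad_kernel_quartic_form_bounded:
  fixes R :: real
  assumes R: "R > 0"
  shows "\<exists>C\<ge>0. \<forall>lam>0. \<forall>g\<in>borel_measurable borel. (\<forall>t. t \<notin> {-R..R} \<longrightarrow> g t = 0) \<longrightarrow>
      (\<integral>\<^sup>+u. \<integral>\<^sup>+v. g (fst u) * g (snd u) * (g (fst v) * g (snd v)) * quad_kernel lam (fst u) (snd u) (fst v) (snd v)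
         \<partial>(lborel \<Otimes>\<^sub>M lborel) \<partial>(lborel \<Otimes>\<^sub>M lborel)) \<le> ennreal (C / lam) * (\<integral>\<^sup>+t. g t ^ 4 \<partial>lborel)"
proof -
  let ?I = "indicator {-R..R} :: real \<Rightarrow> ennreal"
  obtain C where C: "C \<ge> 0" and bound: "\<And>lam a. lam > 0 \<Longrightarrow> a \<in> {-R..R} \<Longrightarrow>
      (\<integral>\<^sup>+t3. \<integral>\<^sup>+t2. \<integral>\<^sup>+t4. ?I t3 * ?I t2 * ?I t4 * quad_kernel lam a t2 t3 t4 \<partial>lborel \<partial>lborel \<partial>lborel) \<le> ennreal (C / lam)"
    using nn_integral_quad_kernel_bounded[OF R] by blast
  let ?P = "lborel \<Otimes>\<^sub>M lborel :: (real \<times> real) measure"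
  interpret S: sigma_finite_measure ?P
    unfolding lborel_prod by (rule lborel.sigma_finite_measure_axioms)
  interpret S2: pair_sigma_finite ?P ?P ..
  have "(\<integral>\<^sup>+u. \<integral>\<^sup>+v. g (fst u) * g (snd u) * (g (fst v) * g (snd v)) * quad_kernel lam (fst u) (snd u) (fst v) (snd v) \<partial>?P \<partial>?P)
      \<le> ennreal (4 * C / lam) * (\<integral>\<^sup>+t. g t ^ 4 \<partial>lborel)"
    if lam: "lam > 0" and [measurable]: "g \<in> borel_measurable borel"
      and g0: "\<And>t. t \<notin> {-R..R} \<Longrightarrow> g t = 0" for lam g
  proof -
    define M where "M s t = (\<integral>\<^sup>+v. ?I (fst v) * ?I (snd v) * quad_kernel lam s t (fst v) (snd v) \<partial>?P)" for s t
    have [measurable]: "(\<lambda>x. M (a x) (b x)) \<in> borel_measurable N"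
      if [measurable]: "a \<in> borel_measurable N" "b \<in> borel_measurable N" for a b :: "'c \<Rightarrow> real" and N
      unfolding M_def by measurable
    have Msym: "M s t = M t s" for s t
      unfolding M_def by (subst quad_kernel_swap12) (rule refl)
    define J where "J t = (\<integral>\<^sup>+s. ?I s * M t s \<partial>lborel)" for t
    have J: "J t \<le> ennreal (C / lam)" if t: "t \<in> {-R..R}" for t
    proof -
      have "J t = (\<integral>\<^sup>+t2. ?I t2 * (\<integral>\<^sup>+t3. \<integral>\<^sup>+t4. ?I t3 * ?I t4 * quad_kernel lam t t2 t3 t4 \<partial>lborel \<partial>lborel) \<partial>lborel)"
        unfolding J_def M_def by (subst lborel.nn_integral_fst[symmetric]) simp_all
      also have "\<dots> = (\<integral>\<^sup>+t2. \<integral>\<^sup>+t3. \<integral>\<^sup>+t4. ?I t3 * ?I t2 * ?I t4 * quad_kernel lam t t2 t3 t4 \<partial>lborel \<partial>lborel \<partial>lborel)"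
        by (simp add: mult_ac flip: nn_integral_cmult)
      also have "\<dots> = (\<integral>\<^sup>+t3. \<integral>\<^sup>+t2. \<integral>\<^sup>+t4. ?I t3 * ?I t2 * ?I t4 * quad_kernel lam t t2 t3 t4 \<partial>lborel \<partial>lborel \<partial>lborel)"
        by (intro lborel_pair.Fubini') measurable
      finally show ?thesis using bound[OF lam t] by simp
    qed
    define X where "X = (\<integral>\<^sup>+u. (g (fst u) * g (snd u))\<^sup>2 * M (fst u) (snd u) \<partial>?P)"
    \<comment> \<open>Separating the pairs removes \<open>g\<close> from one of them, and with it
      the restriction to a bounded set. The cutoffs keep that restriction.\<close>
    let ?k = "\<lambda>u v. ?I (fst u) * ?I (snd u) * (?I (fst v) * ?I (snd v)) * quad_kernel lam (fst u) (snd u) (fst v) (snd v)"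
    have a1: "(\<integral>\<^sup>+u. \<integral>\<^sup>+v. (g (fst u) * g (snd u))\<^sup>2 * ?k u v \<partial>?P \<partial>?P) \<le> X"
    proof -
      have "(\<integral>\<^sup>+u. \<integral>\<^sup>+v. (g (fst u) * g (snd u))\<^sup>2 * ?k u v \<partial>?P \<partial>?P)
          \<le> (\<integral>\<^sup>+u. \<integral>\<^sup>+v. (g (fst u) * g (snd u))\<^sup>2 * (?I (fst v) * ?I (snd v) * quad_kernel lam (fst u) (snd u) (fst v) (snd v)) \<partial>?P \<partial>?P)"
        by (intro nn_integral_mono mult_left_mono) (auto simp: indicator_def)
      also have "\<dots> = X" unfolding X_def M_def by (simp add: nn_integral_cmult)
      finally show ?thesis .
    qed
    have "(\<integral>\<^sup>+u. \<integral>\<^sup>+v. (g (fst v) * g (snd v))\<^sup>2 * ?k u v \<partial>?P \<partial>?P) = (\<integral>\<^sup>+v. \<integral>\<^sup>+u. (g (fst v) * g (snd v))\<^sup>2 * ?k u v \<partial>?P \<partial>?P)"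
      by (intro S2.Fubini') measurable
    also have "\<dots> = (\<integral>\<^sup>+u. \<integral>\<^sup>+v. (g (fst u) * g (snd u))\<^sup>2 * ?k u v \<partial>?P \<partial>?P)"
      by (subst quad_kernel_swap_pairs) (simp add: mult_ac)
    finally have a2: "(\<integral>\<^sup>+u. \<integral>\<^sup>+v. (g (fst v) * g (snd v))\<^sup>2 * ?k u v \<partial>?P \<partial>?P) \<le> X" using a1 by simp
    have X: "X \<le> 2 * (ennreal (C / lam) * (\<integral>\<^sup>+t. g t ^ 4 \<partial>lborel))"
    proof -
      have "X = (\<integral>\<^sup>+s. \<integral>\<^sup>+t. (g s * g t)\<^sup>2 * M s t \<partial>lborel \<partial>lborel)"
        unfolding X_def by (subst lborel.nn_integral_fst[symmetric]) simp_all
      also have "\<dots> \<le> (\<integral>\<^sup>+s. \<integral>\<^sup>+t. g s ^ 4 * (?I s * ?I t * M s t) + g t ^ 4 * (?I s * ?I t * M s t) \<partial>lborel \<partial>lborel)"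
      proof (intro nn_integral_mono)
        fix s t
        have "(g s * g t)\<^sup>2 = ((g s)\<^sup>2 * (g t)\<^sup>2) * (?I s * ?I t)"
          by (cases "s \<in> {-R..R} \<and> t \<in> {-R..R}") (auto simp: indicator_def power_mult_distrib g0)
        also have "\<dots> \<le> (((g s)\<^sup>2)\<^sup>2 + ((g t)\<^sup>2)\<^sup>2) * (?I s * ?I t)"
          by (intro mult_right_mono ennreal_mult_le_add_squares) auto
        also have "\<dots> = (g s ^ 4 + g t ^ 4) * (?I s * ?I t)" by simp
        finally show "(g s * g t)\<^sup>2 * M s t \<le> g s ^ 4 * (?I s * ?I t * M s t) + g t ^ 4 * (?I s * ?I t * M s t)"
          by (auto simp: mult.assoc distrib_right intro: order_trans[OF mult_right_mono])
      qed
      also have "\<dots> = (\<integral>\<^sup>+s. \<integral>\<^sup>+t. g s ^ 4 * (?I s * ?I t * M s t) \<partial>lborel \<partial>lborel) + (\<integral>\<^sup>+s. \<integral>\<^sup>+t. g t ^ 4 * (?I s * ?I t * M s t) \<partial>lborel \<partial>lborel)"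
        by (simp add: nn_integral_add)
      also have "(\<integral>\<^sup>+s. \<integral>\<^sup>+t. g t ^ 4 * (?I s * ?I t * M s t) \<partial>lborel \<partial>lborel) = (\<integral>\<^sup>+t. \<integral>\<^sup>+s. g t ^ 4 * (?I s * ?I t * M s t) \<partial>lborel \<partial>lborel)"
        by (intro lborel_pair.Fubini') measurable
      also have "\<dots> = (\<integral>\<^sup>+s. \<integral>\<^sup>+t. g s ^ 4 * (?I s * ?I t * M s t) \<partial>lborel \<partial>lborel)"
        by (subst Msym) (simp add: mult_ac)
      also have "\<dots> = (\<integral>\<^sup>+s. g s ^ 4 * (?I s * J s) \<partial>lborel)"
        unfolding J_def by (simp add: mult.assoc nn_integral_cmult)
      also have "\<dots> \<le> (\<integral>\<^sup>+s. ennreal (C / lam) * g s ^ 4 \<partial>lborel)"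
        using J by (intro nn_integral_mono) (auto simp: indicator_def mult.commute intro: mult_right_mono)
      also have "\<dots> = ennreal (C / lam) * (\<integral>\<^sup>+s. g s ^ 4 \<partial>lborel)" by (simp add: nn_integral_cmult)
      finally show ?thesis by (simp add: mult_2 add_mono)
    qed
    have "(\<integral>\<^sup>+u. \<integral>\<^sup>+v. g (fst u) * g (snd u) * (g (fst v) * g (snd v)) * quad_kernel lam (fst u) (snd u) (fst v) (snd v) \<partial>?P \<partial>?P)
       \<le> (\<integral>\<^sup>+u. \<integral>\<^sup>+v. (g (fst u) * g (snd u))\<^sup>2 * ?k u v + (g (fst v) * g (snd v))\<^sup>2 * ?k u v \<partial>?P \<partial>?P)"
    proof (intro nn_integral_mono)
      fix u v
      let ?i = "?I (fst u) * ?I (snd u) * (?I (fst v) * ?I (snd v))"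
      have "g (fst u) * g (snd u) * (g (fst v) * g (snd v)) = g (fst u) * g (snd u) * (g (fst v) * g (snd v)) * ?i"
        by (cases "fst u \<in> {-R..R} \<and> snd u \<in> {-R..R} \<and> fst v \<in> {-R..R} \<and> snd v \<in> {-R..R}") (auto simp: indicator_def g0)
      also have "\<dots> \<le> ((g (fst u) * g (snd u))\<^sup>2 + (g (fst v) * g (snd v))\<^sup>2) * ?i"
        by (intro mult_right_mono ennreal_mult_le_add_squares) auto
      finally have "g (fst u) * g (snd u) * (g (fst v) * g (snd v)) * quad_kernel lam (fst u) (snd u) (fst v) (snd v)
          \<le> ((g (fst u) * g (snd u))\<^sup>2 + (g (fst v) * g (snd v))\<^sup>2) * ?i * quad_kernel lam (fst u) (snd u) (fst v) (snd v)"
        by (rule mult_right_mono) auto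
      then show "g (fst u) * g (snd u) * (g (fst v) * g (snd v)) * quad_kernel lam (fst u) (snd u) (fst v) (snd v)
          \<le> (g (fst u) * g (snd u))\<^sup>2 * ?k u v + (g (fst v) * g (snd v))\<^sup>2 * ?k u v"
        by (simp add: distrib_right mult.assoc)
    qed
    also have "\<dots> = (\<integral>\<^sup>+u. \<integral>\<^sup>+v. (g (fst u) * g (snd u))\<^sup>2 * ?k u v \<partial>?P \<partial>?P) + (\<integral>\<^sup>+u. \<integral>\<^sup>+v. (g (fst v) * g (snd v))\<^sup>2 * ?k u v \<partial>?P \<partial>?P)"
      by (simp add: nn_integral_add)
    also have "\<dots> \<le> X + X" by (intro add_mono a1 a2)
    also have "\<dots> \<le> 2 * (ennreal (C / lam) * (\<integral>\<^sup>+t. g t ^ 4 \<partial>lborel)) + 2 * (ennreal (C / lam) * (\<integral>\<^sup>+t. g t ^ 4 \<partial>lborel))"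
      by (intro add_mono X)
    also have "\<dots> = 4 * ennreal (C / lam) * (\<integral>\<^sup>+t. g t ^ 4 \<partial>lborel)"
      by (simp add: mult.assoc flip: distrib_right)
    also have "4 * ennreal (C / lam) = ennreal (4 * C / lam)"
      using C lam by (simp add: ennreal_mult' flip: times_divide_eq_right)
    finally show ?thesis .
  qed
  then show ?thesis
    using C by (intro exI[of _ "4 * C"] conjI allI ballI impI) (simp, blast)
qed

section \<open>The extension estimate with Gaussian weight\<close>

lemma (in pair_sigma_finite) integrable_mult_pair:
  fixes f :: "_ \<Rightarrow> complex" and g :: "_ \<Rightarrow> complex"
  assumes f: "integrable M1 f" and g: "integrable M2 g"
  shows "integrable (M1 \<Otimes>\<^sub>M M2) (\<lambda>p. f (fst p) * g (snd p))"
  unfolding integrable_iff_bounded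
proof
  have [measurable]: "f \<in> borel_measurable M1" "g \<in> borel_measurable M2" using f g by auto
  show "(\<lambda>p. f (fst p) * g (snd p)) \<in> borel_measurable (M1 \<Otimes>\<^sub>M M2)" by measurable
  have "(\<integral>\<^sup>+p. ennreal (norm (f (fst p) * g (snd p))) \<partial>(M1 \<Otimes>\<^sub>M M2)) = (\<integral>\<^sup>+s. \<integral>\<^sup>+t. ennreal (norm (f s)) * ennreal (norm (g t)) \<partial>M2 \<partial>M1)"
    by (subst M2.nn_integral_fst[symmetric]) (auto simp: norm_mult ennreal_mult)
  also have "\<dots> = (\<integral>\<^sup>+s. ennreal (norm (f s)) \<partial>M1) * (\<integral>\<^sup>+t. ennreal (norm (g t)) \<partial>M2)"
    by (simp add: nn_integral_cmult nn_integral_multc)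
  also have "\<dots> < \<infinity>"
    using f g unfolding integrable_iff_bounded by (simp add: ennreal_mult_less_top)
  finally show "(\<integral>\<^sup>+p. ennreal (norm (f (fst p) * g (snd p))) \<partial>(M1 \<Otimes>\<^sub>M M2)) < \<infinity>" .
qed

lemma (in pair_sigma_finite) integral_mult_pair:
  fixes f :: "_ \<Rightarrow> complex" and g :: "_ \<Rightarrow> complex"
  assumes f: "integrable M1 f" and g: "integrable M2 g"
  shows "(\<integral>p. f (fst p) * g (snd p) \<partial>(M1 \<Otimes>\<^sub>M M2)) = (\<integral>s. f s \<partial>M1) * (\<integral>t. g t \<partial>M2)"
proof -
  have "(\<integral>p. f (fst p) * g (snd p) \<partial>(M1 \<Otimes>\<^sub>M M2)) = (\<integral>s. \<integral>t. f s * g t \<partial>M2 \<partial>M1)"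
    using integral_fst'[OF integrable_mult_pair[OF f g]] by simp
  then show ?thesis using f g by simp
qed

text \<open>The T T* argument: the square is a double integral over (s, t) for each z, and
  finiteness of \<open>M\<close> together with |e| \<le> 1 allows the z-integral to be moved inside.
  Absolute values are taken only outside the z-integral, so its cancellation is kept.\<close>

lemma nn_integral_norm_square_oscillatory_le:
  fixes e :: "'z \<Rightarrow> 't \<Rightarrow> complex" and G :: "'t \<Rightarrow> complex"
  assumes "finite_measure M" "sigma_finite_measure N"
    and e [measurable]: "case_prod e \<in> borel_measurable (M \<Otimes>\<^sub>M N)"
    and e1: "\<And>z t. norm (e z t) \<le> 1"
    and G: "integrable N G"
  shows "(\<integral>\<^sup>+z. ennreal ((norm (\<integral>t. G t * e z t \<partial>N))\<^sup>2) \<partial>M)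
    \<le> (\<integral>\<^sup>+s. \<integral>\<^sup>+t. ennreal (norm (G s)) * ennreal (norm (G t)) * ennreal (norm (\<integral>z. e z s * cnj (e z t) \<partial>M)) \<partial>N \<partial>N)"
proof -
  interpret M: finite_measure M by fact
  interpret N: sigma_finite_measure N by fact
  interpret MN: pair_sigma_finite M N ..
  interpret NN: pair_sigma_finite N N ..
  have P: "sigma_finite_measure (N \<Otimes>\<^sub>M N)" by (rule NN.sigma_finite_measure_axioms)
  interpret MP: pair_sigma_finite M "N \<Otimes>\<^sub>M N" ..
  have [measurable]: "cnj \<in> borel_measurable borel"
    by (intro borel_measurable_continuous_onI continuous_intros)
  have [measurable]: "G \<in> borel_measurable N" using G by auto
  have Ge: "integrable N (\<lambda>t. G t * e z t)" if [measurable]: "z \<in> space M" for z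
    by (rule Bochner_Integration.integrable_bound[OF G]) (use e1 in \<open>auto simp: norm_mult mult_left_le\<close>)
  define F where "F z = (\<integral>t. G t * e z t \<partial>N)" for z
  have [measurable]: "F \<in> borel_measurable M" unfolding F_def by measurable
  define H where "H z p = (G (fst p) * e z (fst p)) * cnj (G (snd p) * e z (snd p))" for z p
  have [measurable]: "case_prod H \<in> borel_measurable (M \<Otimes>\<^sub>M (N \<Otimes>\<^sub>M N))"
    unfolding H_def by measurable
  have Hprod: "(\<integral>p. H z p \<partial>(N \<Otimes>\<^sub>M N)) = F z * cnj (F z)" if "z \<in> space M" for z
    using NN.integral_mult_pair[OF Ge[OF that] integrable_cnj[OF Ge[OF that]]]
    unfolding H_def F_def Bochner_Integration.integral_cnj .
  define B where "B = (\<integral>\<^sup>+t. ennreal (norm (G t)) \<partial>N)"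
  have emM: "emeasure M (space M) < \<infinity>" by (simp add: M.emeasure_finite flip: less_top)
  have B: "B < \<infinity>" using G unfolding integrable_iff_bounded B_def by simp
  have HG: "norm (H z p) \<le> norm (G (fst p)) * norm (G (snd p))" for z p
    unfolding H_def using e1[of z "fst p"] e1[of z "snd p"]
    by (auto simp: norm_mult intro!: mult_mono mult_left_le)
  have Hint: "integrable (M \<Otimes>\<^sub>M (N \<Otimes>\<^sub>M N)) (case_prod H)"
    unfolding integrable_iff_bounded
  proof
    have "(\<integral>\<^sup>+x. ennreal (norm (case_prod H x)) \<partial>(M \<Otimes>\<^sub>M (N \<Otimes>\<^sub>M N))) = (\<integral>\<^sup>+z. \<integral>\<^sup>+p. ennreal (norm (H z p)) \<partial>(N \<Otimes>\<^sub>M N) \<partial>M)"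
      by (subst sigma_finite_measure.nn_integral_fst[OF P, symmetric]) auto
    also have "\<dots> \<le> (\<integral>\<^sup>+z. \<integral>\<^sup>+p. ennreal (norm (G (fst p))) * ennreal (norm (G (snd p))) \<partial>(N \<Otimes>\<^sub>M N) \<partial>M)"
      by (intro nn_integral_mono) (use HG in \<open>auto simp flip: ennreal_mult intro!: ennreal_leI\<close>)
    also have "\<dots> = (\<integral>\<^sup>+z. \<integral>\<^sup>+s. \<integral>\<^sup>+t. ennreal (norm (G s)) * ennreal (norm (G t)) \<partial>N \<partial>N \<partial>M)"
      by (subst N.nn_integral_fst[symmetric]) auto
    also have "\<dots> = B * B * emeasure M (space M)"
      unfolding B_def by (simp add: nn_integral_cmult nn_integral_multc)
    also have "\<dots> < \<infinity>" using B emM by (simp add: ennreal_mult_less_top)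
    finally show "(\<integral>\<^sup>+x. ennreal (norm (case_prod H x)) \<partial>(M \<Otimes>\<^sub>M (N \<Otimes>\<^sub>M N))) < \<infinity>" .
  qed measurable
  have FF: "F z * cnj (F z) = complex_of_real ((norm (F z))\<^sup>2)" for z
    by (simp add: complex_mult_cnj cmod_power2)
  have "integrable M (\<lambda>z. \<integral>p. H z p \<partial>(N \<Otimes>\<^sub>M N))"
    using MP.integrable_fst[OF Hint] .
  then have "integrable M (\<lambda>z. complex_of_real ((norm (F z))\<^sup>2))"
    by (subst (asm) Bochner_Integration.integrable_cong[OF refl]) (auto simp: Hprod FF)
  then have intF: "integrable M (\<lambda>z. (norm (F z))\<^sup>2)" by (simp only: complex_of_real_integrable_eq)
  have "complex_of_real (\<integral>z. (norm (F z))\<^sup>2 \<partial>M) = (\<integral>z. \<integral>p. H z p \<partial>(N \<Otimes>\<^sub>M N) \<partial>M)"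
    by (subst integral_complex_of_real[symmetric], rule Bochner_Integration.integral_cong) (auto simp: Hprod FF)
  also have "\<dots> = (\<integral>p. \<integral>z. H z p \<partial>M \<partial>(N \<Otimes>\<^sub>M N))"
    by (rule MP.Fubini_integral[symmetric]) (rule Hint)
  finally have eq: "complex_of_real (\<integral>z. (norm (F z))\<^sup>2 \<partial>M) = (\<integral>p. \<integral>z. H z p \<partial>M \<partial>(N \<Otimes>\<^sub>M N))" .
  have "(\<integral>\<^sup>+z. ennreal ((norm (F z))\<^sup>2) \<partial>M) = ennreal (\<integral>z. (norm (F z))\<^sup>2 \<partial>M)"
    by (intro nn_integral_eq_integral intF) auto
  also have "\<dots> = ennreal (norm (\<integral>p. \<integral>z. H z p \<partial>M \<partial>(N \<Otimes>\<^sub>M N)))"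
    unfolding eq[symmetric] by simp
  also have "\<dots> \<le> (\<integral>\<^sup>+p. norm (\<integral>z. H z p \<partial>M) \<partial>(N \<Otimes>\<^sub>M N))"
    by (rule integral_norm_bound_ennreal) (rule MP.integrable_snd[OF Hint])
  also have "\<dots> = (\<integral>\<^sup>+p. ennreal (norm (G (fst p))) * ennreal (norm (G (snd p))) * ennreal (norm (\<integral>z. e z (fst p) * cnj (e z (snd p)) \<partial>M)) \<partial>(N \<Otimes>\<^sub>M N))"
  proof (rule nn_integral_cong)
    fix p
    have "(\<integral>z. H z p \<partial>M) = (\<integral>z. (G (fst p) * cnj (G (snd p))) * (e z (fst p) * cnj (e z (snd p))) \<partial>M)"
      unfolding H_def by (simp add: mult_ac)
    also have "\<dots> = (G (fst p) * cnj (G (snd p))) * (\<integral>z. e z (fst p) * cnj (e z (snd p)) \<partial>M)"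
      by simp
    finally show "ennreal (norm (\<integral>z. H z p \<partial>M)) = ennreal (norm (G (fst p))) * ennreal (norm (G (snd p))) * ennreal (norm (\<integral>z. e z (fst p) * cnj (e z (snd p)) \<partial>M))"
      by (simp add: norm_mult ennreal_mult)
  qed
  also have "\<dots> = (\<integral>\<^sup>+s. \<integral>\<^sup>+t. ennreal (norm (G s)) * ennreal (norm (G t)) * ennreal (norm (\<integral>z. e z s * cnj (e z t) \<partial>M)) \<partial>N \<partial>N)"
    by (subst N.nn_integral_fst[symmetric]) auto
  finally show ?thesis unfolding F_def .
qed

section \<open>Gaussian Fourier transforms\<close>

lemma fourier_std_normal:
  "(\<integral>u. complex_of_real (std_normal_density u) * iexp (t * u) \<partial>lborel) = complex_of_real (exp (- (t\<^sup>2) / 2))"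
proof -
  have "(\<integral>u. iexp (t * u) \<partial>std_normal_distribution) = complex_of_real (exp (- (t\<^sup>2) / 2))"
    using fun_cong[OF char_std_normal_distribution, of t] unfolding char_def .
  then show ?thesis
    by (subst (asm) integral_density) (auto simp: scaleR_conv_of_real)
qed

text \<open>Completing the square, the product of the two densities is exp (-q^2 / 4) times a
  Gaussian centred at -q/2 with variance 1/2. In the normalized variable u, with y = -q/2 + u / sqrt
  2, the quadratic terms of the phase cancel and it becomes
  \<open>(sqrt 2 * \<theta> * q) * u\<close>.\<close>

lemma norm_fourier_std_normal_correlation:
  "norm (\<integral>y. complex_of_real (std_normal_density (y + q) * std_normal_density y) * iexp (\<theta> * ((y + q)\<^sup>2 - y\<^sup>2)) \<partial>lborel)
     \<le> 1 / (2 * sqrt pi) * exp (- (sqrt 2 * \<theta> * q)\<^sup>2 / 2)"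
proof -
  let ?f = "\<lambda>y. complex_of_real (std_normal_density (y + q) * std_normal_density y) * iexp (\<theta> * ((y + q)\<^sup>2 - y\<^sup>2))"
  have f: "?f (- (q/2) + (1 / sqrt 2) * u) = complex_of_real (1 / sqrt (2 * pi) * exp (- q\<^sup>2 / 4)) *
      (complex_of_real (std_normal_density u) * iexp ((sqrt 2 * \<theta> * q) * u))" for u
  proof -
    have 1: "std_normal_density (- (q/2) + (1 / sqrt 2) * u + q) * std_normal_density (- (q/2) + (1 / sqrt 2) * u)
       = 1 / sqrt (2 * pi) * exp (- q\<^sup>2 / 4) * std_normal_density u"
    proof -
      have "- (- (q/2) + (1 / sqrt 2) * u + q)\<^sup>2 / 2 + - (- (q/2) + (1 / sqrt 2) * u)\<^sup>2 / 2 = - q\<^sup>2 / 4 + - u\<^sup>2 / 2"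
        by (simp add: power2_eq_square field_simps)
      then have "exp (- (- (q/2) + (1 / sqrt 2) * u + q)\<^sup>2 / 2) * exp (- (- (q/2) + (1 / sqrt 2) * u)\<^sup>2 / 2) = exp (- q\<^sup>2 / 4) * exp (- u\<^sup>2 / 2)"
        by (simp only: exp_add[symmetric])
      then show ?thesis unfolding std_normal_density_def by (simp add: mult_ac)
    qed
    have s: "sqrt 2 * sqrt 2 = (2::real)" by simp
    have "\<theta> * ((- (q/2) + (1 / sqrt 2) * u + q)\<^sup>2 - (- (q/2) + (1 / sqrt 2) * u)\<^sup>2) = \<theta> * (2 / sqrt 2) * q * u"
      by (simp add: power2_eq_square field_simps)
    also have "2 / sqrt 2 = sqrt (2::real)" by (simp add: real_div_sqrt)
    finally have 2: "\<theta> * ((- (q/2) + (1 / sqrt 2) * u + q)\<^sup>2 - (- (q/2) + (1 / sqrt 2) * u)\<^sup>2) = (sqrt 2 * \<theta> * q) * u"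
      by (simp add: mult_ac)
    show ?thesis unfolding 1 2 by simp
  qed
  have "(\<integral>y. ?f y \<partial>lborel) = (1 / sqrt 2) *\<^sub>R (\<integral>u. ?f (- (q/2) + (1 / sqrt 2) * u) \<partial>lborel)"
    using lborel_integral_real_affine[of "1 / sqrt 2" ?f "- (q/2)"] by simp
  also have "\<dots> = complex_of_real (1 / sqrt 2 * (1 / sqrt (2 * pi) * exp (- q\<^sup>2 / 4)) * exp (- (sqrt 2 * \<theta> * q)\<^sup>2 / 2))"
    unfolding f integral_mult_right_zero fourier_std_normal by (simp add: scaleR_conv_of_real)
  also have "norm \<dots> = 1 / sqrt 2 * (1 / sqrt (2 * pi) * exp (- q\<^sup>2 / 4)) * exp (- (sqrt 2 * \<theta> * q)\<^sup>2 / 2)"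
    unfolding norm_of_real by (rule abs_of_nonneg) simp
  \<comment> \<open>The factor \<open>exp (- q\<^sup>2 / 4)\<close> is given up: the second
    exponential alone is integrable in \<open>q\<close>, and its integral carries the decay in
    \<theta>.\<close>
  also have "\<dots> \<le> 1 / sqrt 2 * (1 / sqrt (2 * pi) * 1) * exp (- (sqrt 2 * \<theta> * q)\<^sup>2 / 2)"
    by (intro mult_right_mono mult_left_mono) auto
  also have "1 / sqrt 2 * (1 / sqrt (2 * pi) * 1) = 1 / (2 * sqrt pi)"
    by (simp add: real_sqrt_mult)
  finally show ?thesis .
qed

text \<open>The square of the integral is a double integral over \<open>(x, y)\<close>; in the variables \<open>q = x - y\<close>
  and \<open>y\<close> the phase is linear in \<open>y\<close>, so that the integral over \<open>y\<close> is a Gaussian Fourier transform.\<close>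

lemma norm_square_chirp_std_normal:
  assumes "\<theta> \<noteq> 0"
  shows "(norm (\<integral>x. iexp (\<theta> * x\<^sup>2) \<partial>std_normal_distribution))\<^sup>2 \<le> 1 / (2 * \<bar>\<theta>\<bar>)"
proof -
  let ?d = std_normal_density
  define a where "a x = complex_of_real (?d x) * iexp (\<theta> * x\<^sup>2)" for x
  have [measurable]: "a \<in> borel_measurable borel" unfolding a_def by measurable
  have ia: "integrable lborel a"
    by (rule Bochner_Integration.integrable_bound[of _ ?d]) (auto simp: a_def norm_mult)
  define I where "I = (\<integral>x. a x \<partial>lborel)"
  have I: "(\<integral>x. iexp (\<theta> * x\<^sup>2) \<partial>std_normal_distribution) = I"
    unfolding I_def a_def by (subst integral_density) (auto simp: scaleR_conv_of_real)
  define h where "h q y = a (y + q) * cnj (a y)" for q y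
  have h: "h q y = complex_of_real (?d (y + q) * ?d y) * iexp (\<theta> * ((y + q)\<^sup>2 - y\<^sup>2))" for q y
    unfolding h_def a_def by (simp add: exp_cnj ring_distribs flip: exp_add)
  have [measurable]: "cnj \<in> borel_measurable borel"
    by (intro borel_measurable_continuous_onI continuous_intros)
  have [measurable]: "case_prod h \<in> borel_measurable (lborel \<Otimes>\<^sub>M lborel)"
    unfolding h_def by measurable
  have hint: "integrable (lborel \<Otimes>\<^sub>M lborel) (case_prod h)"
    unfolding integrable_iff_bounded
  proof
    have n1: "(\<integral>\<^sup>+x. ennreal (?d x) \<partial>lborel) = 1" by (subst nn_integral_eq_integral) auto
    have n2: "(\<integral>\<^sup>+q. ennreal (?d (y + q)) \<partial>lborel) = 1" for y
      using nn_integral_real_affine[of "\<lambda>x. ennreal (?d x)" 1 y] n1 by simp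
    have "(\<integral>\<^sup>+z. ennreal (norm (case_prod h z)) \<partial>(lborel \<Otimes>\<^sub>M lborel)) = (\<integral>\<^sup>+q. \<integral>\<^sup>+y. ennreal (?d (y + q)) * ennreal (?d y) \<partial>lborel \<partial>lborel)"
      by (subst lborel.nn_integral_fst[symmetric]) (auto simp: h norm_mult ennreal_mult)
    also have "\<dots> = (\<integral>\<^sup>+y. \<integral>\<^sup>+q. ennreal (?d (y + q)) * ennreal (?d y) \<partial>lborel \<partial>lborel)"
      by (intro lborel_pair.Fubini') measurable
    also have "\<dots> = 1" by (simp add: nn_integral_multc n1 n2)
    finally show "(\<integral>\<^sup>+z. ennreal (norm (case_prod h z)) \<partial>(lborel \<Otimes>\<^sub>M lborel)) < \<infinity>" by simp
  qed measurable
  have "I * cnj I = (\<integral>y. I * cnj (a y) \<partial>lborel)"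
    unfolding I_def using ia by simp
  also have "\<dots> = (\<integral>y. \<integral>q. h q y \<partial>lborel \<partial>lborel)"
  proof (rule Bochner_Integration.integral_cong[OF refl])
    fix y
    have "I = (\<integral>q. a (y + q) \<partial>lborel)"
      unfolding I_def using lborel_integral_real_affine[of 1 a y] by simp
    then show "I * cnj (a y) = (\<integral>q. h q y \<partial>lborel)" unfolding h_def by simp
  qed
  also have "\<dots> = (\<integral>q. \<integral>y. h q y \<partial>lborel \<partial>lborel)"
    by (rule lborel_pair.Fubini_integral[OF hint])
  finally have eq: "I * cnj I = (\<integral>q. \<integral>y. h q y \<partial>lborel \<partial>lborel)" .
  have "ennreal ((norm I)\<^sup>2) = ennreal (norm (\<integral>q. \<integral>y. h q y \<partial>lborel \<partial>lborel))"
    unfolding eq[symmetric] by (simp add: norm_mult power2_eq_square)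
  also have "\<dots> \<le> (\<integral>\<^sup>+q. norm (\<integral>y. h q y \<partial>lborel) \<partial>lborel)"
    by (rule integral_norm_bound_ennreal) (rule lborel_pair.integrable_fst[OF hint])
  also have "\<dots> \<le> (\<integral>\<^sup>+q. ennreal (1 / (2 * sqrt pi)) * ennreal (exp (- ((sqrt 2 * \<theta>) * q + 0)\<^sup>2 / 2)) \<partial>lborel)"
    unfolding h using norm_fourier_std_normal_correlation
    by (intro nn_integral_mono) (auto simp flip: ennreal_mult intro!: ennreal_leI)
  also have "\<dots> = ennreal (1 / (2 * sqrt pi)) * (\<integral>\<^sup>+q. ennreal (exp (- ((sqrt 2 * \<theta>) * q + 0)\<^sup>2 / 2)) \<partial>lborel)"
    by (intro nn_integral_cmult) measurable
  also have "\<dots> = ennreal (1 / (2 * sqrt pi)) * ennreal (sqrt (2 * pi) / \<bar>sqrt 2 * \<theta>\<bar>)"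
    by (subst nn_integral_exp_neg_square_affine) (use assms in auto)
  also have "\<dots> = ennreal (1 / (2 * \<bar>\<theta>\<bar>))"
    by (simp add: real_sqrt_mult abs_mult flip: ennreal_mult)
  finally show ?thesis unfolding I using assms by (simp add: ennreal_le_iff)
qed

abbreviation osc :: "real \<Rightarrow> real \<times> real \<Rightarrow> real \<Rightarrow> complex" where
  "osc lam z t \<equiv> iexp (lam * ((fst z)\<^sup>2 * t + snd z * t\<^sup>2))"

text \<open>A weight that dominates Lebesgue measure on bounded sets up to a constant, is finite,
  and is a product. The integrals over \<open>x\<close> and \<open>y\<close> separate, and the one
  over \<open>y\<close> is a characteristic function known exactly.\<close>

abbreviation gauss2 :: "(real \<times> real) measure" where
  "gauss2 \<equiv> std_normal_distribution \<Otimes>\<^sub>M std_normal_distribution"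

lemma prob_space_std_normal: "prob_space std_normal_distribution"
  by (rule prob_space_normal_density) simp

lemma prob_space_gauss2: "prob_space gauss2"
proof -
  interpret prob_space std_normal_distribution by (rule prob_space_std_normal)
  interpret pair_prob_space std_normal_distribution std_normal_distribution ..
  show ?thesis by (rule prob_space_axioms)
qed

text \<open>The four phases add up to lam * (U * x^2 + V * y). The \<open>y\<close> integral is the
  Gaussian characteristic function at lam * V; the \<open>x\<close> integral is a chirp, whose
  stationary point x = 0 limits its decay to the power -1/2 of lam * |U|.\<close>

lemma norm_osc_correlation_le:
  assumes lam: "lam > 0"
  shows "ennreal (norm (\<integral>z. osc lam z s * osc lam z t * cnj (osc lam z s' * osc lam z t') \<partial>gauss2))
    \<le> ennreal (lam powr (-1/2)) * quad_kernel lam s t s' t'"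
proof (cases "s + t - s' - t' = 0")
  case True
  \<comment> \<open>For U = 0 the chirp does not decay, but the right-hand side is \<infinity>,
    because the exponential factor of the kernel is positive.\<close>
  then show ?thesis using lam unfolding quad_kernel_def by (simp add: ennreal_mult_top ennreal_top_mult)
next
  case False
  define U where "U = s + t - s' - t'"
  define V where "V = s\<^sup>2 + t\<^sup>2 - s'\<^sup>2 - t'\<^sup>2"
  let ?N = "std_normal_distribution"
  interpret prob_space ?N by (rule prob_space_std_normal)
  interpret P: pair_sigma_finite ?N ?N ..
  have e: "osc lam z s * osc lam z t * cnj (osc lam z s' * osc lam z t')
      = iexp ((lam * U) * (fst z)\<^sup>2) * iexp ((lam * V) * snd z)" for z
    by (simp add: exp_cnj exp_add[symmetric] U_def V_def algebra_simps)
  have int: "integrable ?N (\<lambda>x. iexp (\<theta> * x\<^sup>2))" "integrable ?N (\<lambda>x. iexp (\<theta> * x))" for \<theta>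
    by (rule integrable_const_bound[of _ 1]; simp)+
  have "(\<integral>z. osc lam z s * osc lam z t * cnj (osc lam z s' * osc lam z t') \<partial>gauss2)
     = (\<integral>x. iexp ((lam * U) * x\<^sup>2) \<partial>?N) * (\<integral>y. iexp ((lam * V) * y) \<partial>?N)"
    unfolding e by (rule P.integral_mult_pair[OF int])
  also have "(\<integral>y. iexp ((lam * V) * y) \<partial>?N) = complex_of_real (exp (- (lam * V)\<^sup>2 / 2))"
    using fun_cong[OF char_std_normal_distribution, of "lam * V"] unfolding char_def .
  finally have n: "norm (\<integral>z. osc lam z s * osc lam z t * cnj (osc lam z s' * osc lam z t') \<partial>gauss2)
     = norm (\<integral>x. iexp ((lam * U) * x\<^sup>2) \<partial>?N) * exp (- (lam * V)\<^sup>2 / 2)"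
    by (simp add: norm_mult)
  have "(norm (\<integral>x. iexp ((lam * U) * x\<^sup>2) \<partial>?N))\<^sup>2 \<le> 1 / (2 * \<bar>lam * U\<bar>)"
    by (rule norm_square_chirp_std_normal) (use lam False in \<open>auto simp: U_def\<close>)
  also have "\<dots> \<le> 1 / (lam * \<bar>U\<bar>)"
    using lam False unfolding U_def[symmetric] by (intro divide_left_mono) (auto simp: abs_mult)
  also have "\<dots> = (lam powr (-1/2) * \<bar>U\<bar> powr (-1/2))\<^sup>2"
    using lam False by (simp add: power_mult_distrib powr_power powr_minus U_def field_simps)
  finally have "norm (\<integral>x. iexp ((lam * U) * x\<^sup>2) \<partial>?N) \<le> lam powr (-1/2) * \<bar>U\<bar> powr (-1/2)"
    by (rule power2_le_imp_le) auto
  then have "norm (\<integral>z. osc lam z s * osc lam z t * cnj (osc lam z s' * osc lam z t') \<partial>gauss2)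
     \<le> lam powr (-1/2) * (\<bar>U\<bar> powr (-1/2) * exp (- (lam * V)\<^sup>2 / 2))"
    unfolding n mult.assoc[symmetric] by (rule mult_right_mono) auto
  then show ?thesis
    using False unfolding quad_kernel_def U_def V_def by (simp flip: ennreal_mult)
qed

text \<open>The square of the one-variable integral is itself an oscillatory integral over pairs,
  with tensor products as input and phase, so the second-moment inequality applies to it. The decay
  is lam powr (-1/2) from the chirp times 1 / lam from the quartic form.\<close>

lemma gaussian_extension_estimate:
  fixes R :: real
  assumes R: "R > 0"
  shows "\<exists>C\<ge>0. \<forall>lam>0. \<forall>g. integrable lborel g \<longrightarrow> (\<forall>t. t \<notin> {-R..R} \<longrightarrow> g t = 0) \<longrightarrow>
     (\<integral>\<^sup>+z. ennreal (norm (\<integral>t. g t * osc lam z t \<partial>lborel) ^ 4) \<partial>gauss2)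
       \<le> ennreal (C * lam powr (-3/2)) * (\<integral>\<^sup>+t. ennreal (norm (g t) ^ 4) \<partial>lborel)"
proof -
  let ?P = "lborel \<Otimes>\<^sub>M lborel :: (real \<times> real) measure"
  obtain C where C: "C \<ge> 0" and bound: "\<forall>lam>0. \<forall>g\<in>borel_measurable borel. (\<forall>t. t \<notin> {-R..R} \<longrightarrow> g t = 0) \<longrightarrow>
      (\<integral>\<^sup>+u. \<integral>\<^sup>+v. g (fst u) * g (snd u) * (g (fst v) * g (snd v)) * quad_kernel lam (fst u) (snd u) (fst v) (snd v)
         \<partial>?P \<partial>?P) \<le> ennreal (C / lam) * (\<integral>\<^sup>+t. g t ^ 4 \<partial>lborel)"
    using quad_kernel_quartic_form_bounded[OF R] by blast
  interpret G2: prob_space gauss2 by (rule prob_space_gauss2)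
  have S: "sigma_finite_measure ?P"
    unfolding lborel_prod by (rule lborel.sigma_finite_measure_axioms)
  have "(\<integral>\<^sup>+z. ennreal (norm (\<integral>t. g t * osc lam z t \<partial>lborel) ^ 4) \<partial>gauss2)
       \<le> ennreal (C * lam powr (-3/2)) * (\<integral>\<^sup>+t. ennreal (norm (g t) ^ 4) \<partial>lborel)"
    if lam: "lam > 0" and g: "integrable lborel g" and g0: "\<forall>t. t \<notin> {-R..R} \<longrightarrow> g t = 0" for lam g
  proof -
    have [measurable]: "g \<in> borel_measurable borel" using g by auto
    have ge: "integrable lborel (\<lambda>t. g t * osc lam z t)" for z
      by (rule Bochner_Integration.integrable_bound[OF g]) (auto simp: norm_mult)
    define e where "e z u = osc lam z (fst u) * osc lam z (snd u)" for z u
    define G where "G u = g (fst u) * g (snd u)" for u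
    have sq: "(\<integral>u. G u * e z u \<partial>?P) = (\<integral>t. g t * osc lam z t \<partial>lborel)\<^sup>2" for z
    proof -
      have "(\<integral>u. G u * e z u \<partial>?P) = (\<integral>u. (g (fst u) * osc lam z (fst u)) * (g (snd u) * osc lam z (snd u)) \<partial>?P)"
        unfolding G_def e_def by (simp only: mult_ac)
      also have "\<dots> = (\<integral>t. g t * osc lam z t \<partial>lborel) * (\<integral>t. g t * osc lam z t \<partial>lborel)"
        by (rule lborel_pair.integral_mult_pair[OF ge ge])
      finally show ?thesis by (simp add: power2_eq_square)
    qed
    have "(\<integral>\<^sup>+z. ennreal (norm (\<integral>t. g t * osc lam z t \<partial>lborel) ^ 4) \<partial>gauss2)
        = (\<integral>\<^sup>+z. ennreal ((norm (\<integral>u. G u * e z u \<partial>?P))\<^sup>2) \<partial>gauss2)"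
      unfolding sq by (simp add: norm_power)
    also have "\<dots> \<le> (\<integral>\<^sup>+u. \<integral>\<^sup>+v. ennreal (norm (G u)) * ennreal (norm (G v)) * ennreal (norm (\<integral>z. e z u * cnj (e z v) \<partial>gauss2)) \<partial>?P \<partial>?P)"
    proof (rule nn_integral_norm_square_oscillatory_le)
      show "case_prod e \<in> borel_measurable (gauss2 \<Otimes>\<^sub>M ?P)" unfolding e_def by measurable
      show "integrable ?P G" unfolding G_def by (rule lborel_pair.integrable_mult_pair[OF g g])
    qed (auto simp: e_def norm_mult G2.finite_measure_axioms S)
    also have "\<dots> \<le> (\<integral>\<^sup>+u. \<integral>\<^sup>+v. ennreal (lam powr (-1/2)) * (ennreal (norm (g (fst u))) * ennreal (norm (g (snd u))) *
        (ennreal (norm (g (fst v))) * ennreal (norm (g (snd v)))) * quad_kernel lam (fst u) (snd u) (fst v) (snd v)) \<partial>?P \<partial>?P)"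
    proof (intro nn_integral_mono)
      fix u v
      have "ennreal (norm (G u)) * ennreal (norm (G v)) * ennreal (norm (\<integral>z. e z u * cnj (e z v) \<partial>gauss2))
         \<le> ennreal (norm (G u)) * ennreal (norm (G v)) * (ennreal (lam powr (-1/2)) * quad_kernel lam (fst u) (snd u) (fst v) (snd v))"
        unfolding e_def by (intro mult_left_mono norm_osc_correlation_le lam) auto
      then show "ennreal (norm (G u)) * ennreal (norm (G v)) * ennreal (norm (\<integral>z. e z u * cnj (e z v) \<partial>gauss2))
         \<le> ennreal (lam powr (-1/2)) * (ennreal (norm (g (fst u))) * ennreal (norm (g (snd u))) *
        (ennreal (norm (g (fst v))) * ennreal (norm (g (snd v)))) * quad_kernel lam (fst u) (snd u) (fst v) (snd v))"
        unfolding G_def norm_mult by (simp add: ennreal_mult mult_ac)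
    qed
    also have "\<dots> = ennreal (lam powr (-1/2)) * (\<integral>\<^sup>+u. \<integral>\<^sup>+v. (ennreal (norm (g (fst u))) * ennreal (norm (g (snd u))) *
        (ennreal (norm (g (fst v))) * ennreal (norm (g (snd v)))) * quad_kernel lam (fst u) (snd u) (fst v) (snd v)) \<partial>?P \<partial>?P)"
      by (simp add: nn_integral_cmult)
    also have "\<dots> \<le> ennreal (lam powr (-1/2)) * (ennreal (C / lam) * (\<integral>\<^sup>+t. ennreal (norm (g t)) ^ 4 \<partial>lborel))"
      by (intro mult_left_mono bound[rule_format, of lam "\<lambda>t. ennreal (norm (g t))"]) (use lam g0 in auto)
    also have "\<dots> = ennreal (lam powr (-1/2) * (C / lam)) * (\<integral>\<^sup>+t. ennreal (norm (g t) ^ 4) \<partial>lborel)"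
      unfolding ennreal_mult[OF powr_ge_zero divide_nonneg_nonneg[OF C less_imp_le[OF lam]]] by (simp add: ennreal_power mult.assoc)
    also have "lam powr (-1/2) * (C / lam) = C * lam powr (-3/2)"
    proof -
      have "lam powr (-3/2) = lam powr (-1/2) * lam powr (-1)"
        using powr_add[of lam "-1/2" "-1"] by simp
      also have "lam powr (-1) = 1 / lam" using lam by (simp add: powr_minus_divide)
      finally show ?thesis by simp
    qed
    finally show ?thesis .
  qed
  then show ?thesis using C by (intro exI[of _ C] conjI allI impI) auto
qed

section \<open>General amplitudes\<close>

lemma norm_triple_greater:
  fixes x y t :: real
  shows "\<bar>x\<bar> > r \<Longrightarrow> norm (x, y, t) > r" "\<bar>y\<bar> > r \<Longrightarrow> norm (x, y, t) > r" "\<bar>t\<bar> > r \<Longrightarrow> norm (x, y, t) > r"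
  using norm_fst_le[of x "(y, t)"] norm_snd_le[of "(y, t)" x] norm_fst_le[of y t] norm_snd_le[of t y]
  by simp_all

lemma frechet_derivative_eq_0_outside:
  fixes f :: "'a::euclidean_space \<Rightarrow> 'b::real_normed_vector"
  assumes "\<And>z. norm z > r \<Longrightarrow> f z = 0" "norm z > r"
  shows "frechet_derivative f (at z) v = 0"
proof -
  have "((\<lambda>_. 0) has_derivative (\<lambda>_. 0)) (at z)" by simp
  then have "(f has_derivative (\<lambda>_. 0)) (at z)"
    by (rule has_derivative_transform_within_open[where s = "{z. norm z > r}"])
       (use assms in \<open>auto intro: open_Collect_less continuous_intros\<close>)
  then show ?thesis by (simp add: frechet_derivative_at[symmetric])
qed

lemma directional_derivative_along_line:
  fixes f :: "'a::euclidean_space \<Rightarrow> 'b::real_normed_vector"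
  assumes "f differentiable (at (a + s *\<^sub>R v))"
  shows "((\<lambda>s. f (a + s *\<^sub>R v)) has_vector_derivative frechet_derivative f (at (a + s *\<^sub>R v)) v) (at s)"
proof -
  have "(f has_derivative frechet_derivative f (at (a + s *\<^sub>R v))) (at (a + s *\<^sub>R v))"
    using assms by (simp add: frechet_derivative_works)
  moreover have "((\<lambda>s. a + s *\<^sub>R v) has_derivative (\<lambda>h. h *\<^sub>R v)) (at s)"
    by (auto intro!: derivative_eq_intros)
  ultimately have "((\<lambda>s. f (a + s *\<^sub>R v)) has_derivative (\<lambda>h. frechet_derivative f (at (a + s *\<^sub>R v)) (h *\<^sub>R v))) (at s)"
    by (rule has_derivative_compose[rotated])
  moreover have "frechet_derivative f (at (a + s *\<^sub>R v)) (h *\<^sub>R v) = h *\<^sub>R frechet_derivative f (at (a + s *\<^sub>R v)) v" for h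
    using linear_frechet_derivative[OF assms] by (rule linear_cmul)
  ultimately show ?thesis by (simp add: has_vector_derivative_def)
qed

text \<open>The fundamental theorem of calculus, started to the left of the support. In this form
  \<open>x\<close> occurs only in the indicator, while the integrand and the domain of integration
  are the same for all \<open>x\<close>.\<close>

lemma compact_support_eq_integral_derivative:
  fixes h h' :: "real \<Rightarrow> complex"
  assumes h: "\<And>s. (h has_vector_derivative h' s) (at s)" and cont: "continuous_on UNIV h'"
    and h0: "\<And>s. \<bar>s\<bar> > r \<Longrightarrow> h s = 0" "\<And>s. \<bar>s\<bar> > r \<Longrightarrow> h' s = 0"
  shows "h x = (\<integral>s. indicator {..x} s *\<^sub>R h' s \<partial>lborel)"
proof -
  \<comment> \<open>The point lies below \<open>x\<close> and strictly beyond the support;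
    \<open>\<bar>r\<bar>\<close> is used because \<open>r\<close> may be negative.\<close>
  define a where "a = min x (- \<bar>r\<bar>) - 1"
  have "(\<integral>s. indicator {a..x} s *\<^sub>R h' s \<partial>lborel) = h x - h a"
    by (rule integral_FTC_Icc)
       (auto simp: a_def intro: has_vector_derivative_at_within h continuous_on_subset[OF cont])
  also have "h a = 0" by (rule h0) (auto simp: a_def)
  also have "(\<integral>s. indicator {a..x} s *\<^sub>R h' s \<partial>lborel) = (\<integral>s. indicator {..x} s *\<^sub>R h' s \<partial>lborel)"
    by (rule Bochner_Integration.integral_cong) (auto simp: indicator_def a_def intro!: h0(2)[symmetric] h0(2))
  finally show ?thesis by simp
qed

lemma C_k_continuous: "C_k k f \<Longrightarrow> continuous_on UNIV f"
  by (cases k) (auto intro: differentiable_imp_continuous_within continuous_at_imp_continuous_on)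

text \<open>Integration of the derivative once in \<open>x\<close> and once in \<open>y\<close>. The
  result writes \<psi> as a superposition of products of a function of (x, y), bounded by 1, and a
  function of \<open>t\<close>; \<open>D\<close> is the mixed derivative.\<close>

lemma smooth_compact_support_eq_integral_mixed_derivative:
  fixes \<psi> :: "real \<times> real \<times> real \<Rightarrow> complex"
  assumes "smooth \<psi>" "compactly_supported \<psi>"
  shows "\<exists>r>0. \<exists>B D. continuous_on UNIV D \<and> (\<forall>z. norm (D z) \<le> B) \<and>
    (\<forall>z. norm z > r \<longrightarrow> \<psi> z = 0 \<and> D z = 0) \<and>
    (\<forall>x y t. \<psi> (x, y, t) = (\<integral>p. (indicator {..x} (fst p) * indicator {..y} (snd p)) *\<^sub>R D (fst p, snd p, t) \<partial>(lborel \<Otimes>\<^sub>M lborel)))"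
proof -
  have "bounded {z. \<psi> z \<noteq> 0}"
    using assms(2) unfolding compactly_supported_def
    by (meson bounded_subset closure_subset compact_imp_bounded)
  then obtain r where r: "r > 0" "\<And>z. \<psi> z \<noteq> 0 \<Longrightarrow> norm z \<le> r"
    unfolding bounded_pos by auto
  have \<psi>0: "\<psi> z = 0" if "norm z > r" for z using r(2)[of z] that by force
  define \<psi>1 where "\<psi>1 z = frechet_derivative \<psi> (at z) (1, 0, 0)" for z
  define D where "D z = frechet_derivative \<psi>1 (at z) (0, 1, 0)" for z
  have C3: "C_k (Suc (Suc 0)) \<psi>" using assms(1) unfolding smooth_def by blast
  then have d1: "\<psi> differentiable (at z)" and C2: "C_k (Suc 0) \<psi>1" for z
    unfolding \<psi>1_def C_k.simps(2)[of "Suc 0"] by blast+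
  then have d2: "\<psi>1 differentiable (at z)" and C1: "continuous_on UNIV D" for z
    unfolding D_def C_k.simps by blast+
  have \<psi>10: "\<psi>1 z = 0" if "norm z > r" for z
    unfolding \<psi>1_def by (rule frechet_derivative_eq_0_outside[OF \<psi>0 that])
  have D0: "D z = 0" if "norm z > r" for z
    unfolding D_def by (rule frechet_derivative_eq_0_outside[OF \<psi>10 that])
  have cont1: "continuous_on UNIV \<psi>1" by (rule C_k_continuous[OF C2])
  note nx = norm_triple_greater(1) and ny = norm_triple_greater(2)
  have 1: "\<psi> (x, y, t) = (\<integral>s. indicator {..x} s *\<^sub>R \<psi>1 (s, y, t) \<partial>lborel)" for x y t
  proof (rule compact_support_eq_integral_derivative)
    fix s
    show "((\<lambda>s. \<psi> (s, y, t)) has_vector_derivative \<psi>1 (s, y, t)) (at s)"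
      using directional_derivative_along_line[where a = "(0, y, t)" and s = s and v = "(1, 0, 0)", OF d1] by (simp add: \<psi>1_def)
    show "\<psi> (s, y, t) = 0" "\<psi>1 (s, y, t) = 0" if "\<bar>s\<bar> > r"
      by (auto intro: \<psi>0 \<psi>10 nx that)
  qed (auto intro!: continuous_on_compose2[OF cont1] continuous_intros)
  have 2: "\<psi>1 (x, y, t) = (\<integral>s. indicator {..y} s *\<^sub>R D (x, s, t) \<partial>lborel)" for x y t
  proof (rule compact_support_eq_integral_derivative)
    fix s
    show "((\<lambda>s. \<psi>1 (x, s, t)) has_vector_derivative D (x, s, t)) (at s)"
      using directional_derivative_along_line[where a = "(x, 0, t)" and s = s and v = "(0, 1, 0)", OF d2] by (simp add: D_def)
    show "\<psi>1 (x, s, t) = 0" "D (x, s, t) = 0" if "\<bar>s\<bar> > r"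
      by (auto intro: D0 \<psi>10 ny that)
  qed (auto intro!: continuous_on_compose2[OF C1] continuous_intros)
  have [measurable]: "D \<in> borel_measurable borel" by (rule borel_measurable_continuous_onI[OF C1])
  have "bounded (D ` cball 0 r)"
    by (intro compact_imp_bounded compact_continuous_image continuous_on_subset[OF C1]) auto
  then obtain B where "\<forall>w\<in>D ` cball 0 r. norm w \<le> B" unfolding bounded_iff by blast
  then have B: "norm (D z) \<le> B" if "norm z \<le> r" for z
    using that by simp
  \<comment> \<open>The bound \<open>B\<close> comes from the ball alone; \<open>max\<close> covers
    the points outside, where \<open>D\<close> vanishes.\<close>
  have B': "norm (D z) \<le> max B 0" for z
    using B[of z] D0[of z] by (cases "norm z \<le> r") auto
  have 3: "\<psi> (x, y, t) = (\<integral>p. (indicator {..x} (fst p) * indicator {..y} (snd p)) *\<^sub>R D (fst p, snd p, t) \<partial>(lborel \<Otimes>\<^sub>M lborel))" for x y t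
  proof -
    let ?h = "\<lambda>p. (indicator {..x} (fst p) * indicator {..y} (snd p)) *\<^sub>R D (fst p, snd p, t)"
    have int: "integrable (lborel \<Otimes>\<^sub>M lborel) ?h"
    proof (rule integrableI_bounded_set[where A = "{-r..r} \<times> {-r..r}" and B = "max B 0"])
      show "AE p in lborel \<Otimes>\<^sub>M lborel. p \<in> {-r..r} \<times> {-r..r} \<longrightarrow> norm (?h p) \<le> max B 0"
        using B' by (intro AE_I2) (auto simp: indicator_def)
      show "AE p in lborel \<Otimes>\<^sub>M lborel. p \<notin> {-r..r} \<times> {-r..r} \<longrightarrow> ?h p = 0"
      proof (intro AE_I2 impI)
        fix p :: "real \<times> real" assume "p \<notin> {-r..r} \<times> {-r..r}"
        then have "\<bar>fst p\<bar> > r \<or> \<bar>snd p\<bar> > r" by (auto simp: mem_Times_iff)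
        then show "?h p = 0" using D0 nx ny by auto
      qed
      show "emeasure (lborel \<Otimes>\<^sub>M lborel) ({-r..r} \<times> {-r..r}) < \<infinity>"
        using r(1) by (subst lborel.emeasure_pair_measure_Times) (auto simp: ennreal_mult_less_top)
    qed measurable
    have "\<psi> (x, y, t) = (\<integral>s. indicator {..x} s *\<^sub>R (\<integral>q. indicator {..y} q *\<^sub>R D (s, q, t) \<partial>lborel) \<partial>lborel)"
      by (subst 1, subst 2, rule refl)
    also have "\<dots> = (\<integral>s. \<integral>q. ?h (s, q) \<partial>lborel \<partial>lborel)"
      by (simp flip: integral_scaleR_right add: mult.commute)
    also have "\<dots> = (\<integral>p. ?h p \<partial>(lborel \<Otimes>\<^sub>M lborel))"
      by (rule lborel_pair.integral_fst'[OF int])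
    finally show ?thesis .
  qed
  show ?thesis using r(1) C1 B' \<psi>0 D0 3
    by (intro exI[of _ r] exI[of _ "max B 0"] exI[of _ D] conjI allI impI)
qed

section \<open>From the Gaussian weight to the operator\<close>

lemma norm_integral_le_nn_integral:
  fixes f :: "'a \<Rightarrow> 'b::{banach, second_countable_topology}"
  shows "ennreal (norm (\<integral>x. f x \<partial>M)) \<le> (\<integral>\<^sup>+x. ennreal (norm (f x)) \<partial>M)"
proof (cases "integrable M f")
  case True
  then show ?thesis by (rule integral_norm_bound_ennreal)
qed (simp add: not_integrable_integral_eq)

text \<open>Hoelder's inequality with exponent 4 on \<open>Q\<close>, obtained from Cauchy-Schwarz
  applied twice.\<close>

lemma nn_integral_power4_le:
  assumes [measurable]: "h \<in> borel_measurable M" "Q \<in> sets M"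
  shows "(\<integral>\<^sup>+p. indicator Q p * h p \<partial>M) ^ 4 \<le> emeasure M Q ^ 3 * (\<integral>\<^sup>+p. indicator Q p * h p ^ 4 \<partial>M)"
proof -
  have cs: "(\<integral>\<^sup>+p. indicator Q p * k p \<partial>M)\<^sup>2 \<le> emeasure M Q * (\<integral>\<^sup>+p. indicator Q p * (k p)\<^sup>2 \<partial>M)"
    if [measurable]: "k \<in> borel_measurable M" for k
  proof -
    \<comment> \<open>The indicator is doubled so that each Cauchy-Schwarz factor keeps one
      copy.\<close>
    have "(\<integral>\<^sup>+p. indicator Q p * k p \<partial>M)\<^sup>2 = (\<integral>\<^sup>+p. indicator Q p * (indicator Q p * k p) \<partial>M)\<^sup>2"
      by (intro arg_cong[where f="\<lambda>x. x\<^sup>2"] nn_integral_cong) (auto simp: indicator_def)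
    also have "\<dots> \<le> (\<integral>\<^sup>+p. (indicator Q p)\<^sup>2 \<partial>M) * (\<integral>\<^sup>+p. (indicator Q p * k p)\<^sup>2 \<partial>M)"
      by (intro Cauchy_Schwarz_nn_integral) measurable
    also have "(\<integral>\<^sup>+p. (indicator Q p)\<^sup>2 \<partial>M) = (\<integral>\<^sup>+p. indicator Q p \<partial>M)"
      by (intro nn_integral_cong) (auto simp: indicator_def)
    also have "(\<integral>\<^sup>+p. (indicator Q p * k p)\<^sup>2 \<partial>M) = (\<integral>\<^sup>+p. indicator Q p * (k p)\<^sup>2 \<partial>M)"
      by (intro nn_integral_cong) (auto simp: indicator_def)
    finally show ?thesis by simp
  qed
  have "(\<integral>\<^sup>+p. indicator Q p * h p \<partial>M) ^ 4 = ((\<integral>\<^sup>+p. indicator Q p * h p \<partial>M)\<^sup>2)\<^sup>2" by simp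
  also have "\<dots> \<le> (emeasure M Q * (\<integral>\<^sup>+p. indicator Q p * (h p)\<^sup>2 \<partial>M))\<^sup>2"
    by (intro power_mono cs) auto
  also have "\<dots> = emeasure M Q ^ 2 * (\<integral>\<^sup>+p. indicator Q p * (h p)\<^sup>2 \<partial>M)\<^sup>2" by (simp add: power_mult_distrib)
  also have "\<dots> \<le> emeasure M Q ^ 2 * (emeasure M Q * (\<integral>\<^sup>+p. indicator Q p * ((h p)\<^sup>2)\<^sup>2 \<partial>M))"
    by (intro mult_left_mono cs) auto
  also have "\<dots> = emeasure M Q ^ 3 * (\<integral>\<^sup>+p. indicator Q p * ((h p)\<^sup>2)\<^sup>2 \<partial>M)"
    by (simp only: mult.assoc power2_eq_square power3_eq_cube)
  also have "\<dots> = emeasure M Q ^ 3 * (\<integral>\<^sup>+p. indicator Q p * h p ^ 4 \<partial>M)" by simp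
  finally show ?thesis .
qed

text \<open>On the square the exponent (x^2 + y^2) / 2 is at most r^2, so the Gaussian density is at
  least exp (-r^2) / (2 * pi) there.\<close>

lemma nn_integral_lborel_le_gauss2:
  fixes h :: "real \<times> real \<Rightarrow> ennreal"
  assumes [measurable]: "h \<in> borel_measurable (lborel \<Otimes>\<^sub>M lborel)"
    and h0: "\<And>z. \<not> (\<bar>fst z\<bar> \<le> r \<and> \<bar>snd z\<bar> \<le> r) \<Longrightarrow> h z = 0"
  shows "(\<integral>\<^sup>+z. h z \<partial>(lborel \<Otimes>\<^sub>M lborel)) \<le> ennreal (2 * pi * exp (r\<^sup>2)) * (\<integral>\<^sup>+z. h z \<partial>gauss2)"
proof -
  interpret prob_space std_normal_distribution by (rule prob_space_std_normal)
  have "(\<integral>\<^sup>+z. h z \<partial>(lborel \<Otimes>\<^sub>M lborel)) = (\<integral>\<^sup>+x. \<integral>\<^sup>+y. h (x, y) \<partial>lborel \<partial>lborel)"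
    by (subst lborel.nn_integral_fst[symmetric]) auto
  also have "\<dots> \<le> (\<integral>\<^sup>+x. \<integral>\<^sup>+y. ennreal (2 * pi * exp (r\<^sup>2)) * (ennreal (std_normal_density x) * (ennreal (std_normal_density y) * h (x, y))) \<partial>lborel \<partial>lborel)"
  proof (intro nn_integral_mono)
    fix x y :: real
    show "h (x, y) \<le> ennreal (2 * pi * exp (r\<^sup>2)) * (ennreal (std_normal_density x) * (ennreal (std_normal_density y) * h (x, y)))"
    proof (cases "\<bar>x\<bar> \<le> r \<and> \<bar>y\<bar> \<le> r")
      case False
      then show ?thesis using h0[of "(x, y)"] by auto
    next
      case True
      then have "x\<^sup>2 \<le> r\<^sup>2" "y\<^sup>2 \<le> r\<^sup>2" by (auto simp: abs_le_square_iff[symmetric])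
      then have "1 \<le> exp (r\<^sup>2 + (- x\<^sup>2 / 2 + - y\<^sup>2 / 2))" by simp
      also have "\<dots> = (2 * pi * exp (r\<^sup>2)) * (std_normal_density x * std_normal_density y)"
      proof -
        have "E * (a * b) = (2 * pi * E) * ((1 / sqrt (2 * pi) * a) * (1 / sqrt (2 * pi) * b))" for E a b
          by (simp add: field_simps)
        then show ?thesis unfolding std_normal_density_def exp_add .
      qed
      finally have "ennreal 1 \<le> ennreal (2 * pi * exp (r\<^sup>2)) * (ennreal (std_normal_density x) * ennreal (std_normal_density y))"
        by (simp flip: ennreal_mult)
      then have "1 * h (x, y) \<le> (ennreal (2 * pi * exp (r\<^sup>2)) * (ennreal (std_normal_density x) * ennreal (std_normal_density y))) * h (x, y)"
        by (intro mult_right_mono) auto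
      then show ?thesis by (simp add: mult.assoc)
    qed
  qed
  also have "\<dots> = ennreal (2 * pi * exp (r\<^sup>2)) * (\<integral>\<^sup>+x. \<integral>\<^sup>+y. h (x, y) \<partial>std_normal_distribution \<partial>std_normal_distribution)"
    by (simp add: nn_integral_cmult nn_integral_density)
  also have "(\<integral>\<^sup>+x. \<integral>\<^sup>+y. h (x, y) \<partial>std_normal_distribution \<partial>std_normal_distribution) = (\<integral>\<^sup>+z. h z \<partial>gauss2)"
    by (rule nn_integral_fst) simp
  finally show ?thesis .
qed

text \<open>For a fixed corner \<open>p\<close> the function \<open>g p\<close> is the input with
  the factor \<open>D\<close> absorbed, and \<open>S p\<close> is its amplitude-free oscillatory
  integral. The operator at \<open>z\<close> is the integral of \<open>S p z\<close> over the
  corners \<open>p\<close> below \<open>z\<close>. The indicators are discarded after taking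
  absolute values, Hoelder over the bounded set \<open>Q\<close> of corners brings the fourth power
  inside, and the Gaussian estimate holds for every \<open>p\<close> with the same constant.\<close>

lemma oscillatory_operator_L4_estimate:
  fixes \<psi> :: "real \<times> real \<times> real \<Rightarrow> complex"
  assumes \<psi>: "smooth \<psi>" "compactly_supported \<psi>"
  shows "\<exists>C\<ge>0. \<forall>lam>0. \<forall>f\<in>borel_measurable borel. (\<integral>\<^sup>+t. ennreal (norm (f t) ^ 4) \<partial>lborel) < \<infinity> \<longrightarrow>
     (\<integral>\<^sup>+z. ennreal (norm (\<integral>t. osc lam z t * \<psi> (fst z, snd z, t) * f t \<partial>lborel) ^ 4) \<partial>(lborel \<Otimes>\<^sub>M lborel))
       \<le> ennreal (C * lam powr (-3/2)) * (\<integral>\<^sup>+t. ennreal (norm (f t) ^ 4) \<partial>lborel)"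
proof -
  let ?P = "lborel \<Otimes>\<^sub>M lborel :: (real \<times> real) measure"
  obtain r B D where r: "r > 0" and D: "continuous_on UNIV D" and "\<forall>z. norm (D z) \<le> B"
    and "\<forall>z. norm z > r \<longrightarrow> \<psi> z = 0 \<and> D z = 0"
    and "\<forall>x y t. \<psi> (x, y, t) = (\<integral>p. (indicator {..x} (fst p) * indicator {..y} (snd p)) *\<^sub>R D (fst p, snd p, t) \<partial>?P)"
    using smooth_compact_support_eq_integral_mixed_derivative[OF \<psi>] by blast
  then have B: "\<And>z. norm (D z) \<le> B" and \<psi>0: "\<And>z. norm z > r \<Longrightarrow> \<psi> z = 0" and D0: "\<And>z. norm z > r \<Longrightarrow> D z = 0"
    and \<psi>D: "\<And>x y t. \<psi> (x, y, t) = (\<integral>p. (indicator {..x} (fst p) * indicator {..y} (snd p)) *\<^sub>R D (fst p, snd p, t) \<partial>?P)"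
    by blast+
  have [measurable]: "D \<in> borel_measurable borel" by (rule borel_measurable_continuous_onI[OF D])
  have [measurable]: "\<psi> \<in> borel_measurable borel"
    using \<psi>(1) C_k_continuous unfolding smooth_def by (blast intro: borel_measurable_continuous_onI)
  note nx = norm_triple_greater(1) and ny = norm_triple_greater(2) and nt = norm_triple_greater(3)
  have B0: "B \<ge> 0" using order_trans[OF norm_ge_zero B] .
  obtain C where C: "C \<ge> 0" and ext: "\<forall>lam>0. \<forall>g. integrable lborel g \<longrightarrow> (\<forall>t. t \<notin> {-r..r} \<longrightarrow> g t = 0) \<longrightarrow>
     (\<integral>\<^sup>+z. ennreal (norm (\<integral>t. g t * osc lam z t \<partial>lborel) ^ 4) \<partial>gauss2)
       \<le> ennreal (C * lam powr (-3/2)) * (\<integral>\<^sup>+t. ennreal (norm (g t) ^ 4) \<partial>lborel)"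
    using gaussian_extension_estimate[OF r] by blast
  define Q where "Q = {-r..r} \<times> {-r..r}"
  have [measurable]: "Q \<in> sets (borel \<Otimes>\<^sub>M borel)" unfolding Q_def by measurable
  have eQ: "emeasure ?P Q = ennreal (2 * r * (2 * r))"
    unfolding Q_def using r by (subst lborel.emeasure_pair_measure_Times) (auto simp flip: ennreal_mult)
  interpret G2: prob_space gauss2 by (rule prob_space_gauss2)
  interpret PG: pair_sigma_finite ?P gauss2
    by (intro pair_sigma_finite.intro G2.sigma_finite_measure_axioms lborel_pair.sigma_finite_measure_axioms)
  have PS: "pair_sigma_finite lborel ?P"
    by (intro pair_sigma_finite.intro lborel.sigma_finite_measure_axioms lborel_pair.sigma_finite_measure_axioms)
  \<comment> \<open>The factors come, in order, from comparing Lebesgue measure with the Gaussian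
    weight, from Hoelder on \<open>Q\<close>, from the estimate for \<open>g p\<close> with |D|
    \<le> B, and from the measure of \<open>Q\<close>.\<close>
  define K where "K = 2 * pi * exp (r\<^sup>2) * ((2 * r * (2 * r)) ^ 3 * (C * B ^ 4 * (2 * r * (2 * r))))"
  have "(\<integral>\<^sup>+z. ennreal (norm (\<integral>t. osc lam z t * \<psi> (fst z, snd z, t) * f t \<partial>lborel) ^ 4) \<partial>?P)
       \<le> ennreal (K * lam powr (-3/2)) * (\<integral>\<^sup>+t. ennreal (norm (f t) ^ 4) \<partial>lborel)"
    if lam: "lam > 0" and [measurable]: "f \<in> borel_measurable borel"
      and fin: "(\<integral>\<^sup>+t. ennreal (norm (f t) ^ 4) \<partial>lborel) < \<infinity>" for lam f
  proof -
    define N where "N = (\<integral>\<^sup>+t. ennreal (norm (f t) ^ 4) \<partial>lborel)"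
    have f4: "integrable lborel (\<lambda>t. norm (f t) ^ 4)"
      using fin by (intro integrableI_bounded) auto
    have floc: "integrable lborel (\<lambda>t. B * (indicator {-r..r} t + norm (f t) ^ 4))"
      using f4 by (intro integrable_mult_right Bochner_Integration.integrable_add) (use r in \<open>auto intro: integrable_real_indicator\<close>)
    have fbound: "norm (D (a, b, t) * f t) \<le> B * (indicator {-r..r} t + norm (f t) ^ 4)" for a b t
    proof (cases "t \<in> {-r..r}")
      case True
      \<comment> \<open>A function in L^4 is integrable only locally, but \<open>D\<close> vanishes
        for |t| > r. This makes the products integrable, as Fubini and the extension estimate
        require.\<close>
      have "norm (f t) \<le> 1 + norm (f t) ^ 4"
        using power_increasing[of 1 4 "norm (f t)"] by (cases "norm (f t) \<le> 1") (auto simp: add_increasing2)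
      then show ?thesis using True B[of "(a, b, t)"] B0 by (auto simp: norm_mult intro!: mult_mono)
    next
      case False
      then have "D (a, b, t) = 0" by (intro D0 nt) auto
      then show ?thesis using B0 by simp
    qed
    define g where "g p t = D (fst p, snd p, t) * f t" for p t
    have [measurable]: "case_prod g \<in> borel_measurable (?P \<Otimes>\<^sub>M lborel)" unfolding g_def by measurable
    have [measurable]: "g p \<in> borel_measurable borel" for p unfolding g_def[abs_def] by measurable
    have gint: "integrable lborel (g p)" for p
      by (rule Bochner_Integration.integrable_bound[OF floc]) (auto simp: g_def fbound intro!: AE_I2 order_trans[OF fbound abs_ge_self] simp del: abs_mult)
    have g0: "g p t = 0" if "t \<notin> {-r..r}" for p t
      unfolding g_def using D0[OF nt] that by auto
    have gQ: "g p t = 0" if "p \<notin> Q" for p t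
      unfolding g_def using D0[OF nx] D0[OF ny] that by (cases p) (fastforce simp: Q_def)
    define S where "S p z = (\<integral>t. g p t * osc lam z t \<partial>lborel)" for p z
    have [measurable]: "case_prod S \<in> borel_measurable (?P \<Otimes>\<^sub>M gauss2)" unfolding S_def by measurable
    have [measurable]: "(\<lambda>p. S p z) \<in> borel_measurable ?P" for z unfolding S_def by measurable
    have [measurable]: "S p \<in> borel_measurable gauss2" for p unfolding S_def[abs_def] by measurable
    define T where "T z = (\<integral>t. osc lam z t * \<psi> (fst z, snd z, t) * f t \<partial>lborel)" for z
    have TS: "T z = (\<integral>p. (indicator {..fst z} (fst p) * indicator {..snd z} (snd p)) *\<^sub>R S p z \<partial>?P)" for z
    proof -
      let ?i = "\<lambda>p. indicator {..fst z} (fst p) * indicator {..snd z} (snd p) :: real"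
      let ?h = "\<lambda>t p. ?i p *\<^sub>R (g p t * osc lam z t)"
      have hint: "integrable (lborel \<Otimes>\<^sub>M ?P) (case_prod ?h)"
      proof (rule integrableI_bounded)
        have "(\<integral>\<^sup>+x. ennreal (norm (case_prod ?h x)) \<partial>(lborel \<Otimes>\<^sub>M ?P)) = (\<integral>\<^sup>+t. \<integral>\<^sup>+p. ennreal (norm (?h t p)) \<partial>?P \<partial>lborel)"
          by (subst sigma_finite_measure.nn_integral_fst[OF lborel_pair.sigma_finite_measure_axioms, symmetric]) auto
        also have "\<dots> \<le> (\<integral>\<^sup>+t. \<integral>\<^sup>+p. ennreal (B * (indicator {-r..r} t + norm (f t) ^ 4)) * indicator Q p \<partial>?P \<partial>lborel)"
        proof (intro nn_integral_mono)
          fix t p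
          show "ennreal (norm (?h t p)) \<le> ennreal (B * (indicator {-r..r} t + norm (f t) ^ 4)) * indicator Q p"
            using fbound[of "fst p" "snd p" t] gQ[of p t]
            by (cases "p \<in> Q") (auto simp: norm_mult g_def indicator_def split: if_splits intro!: ennreal_leI)
        qed
        also have "\<dots> = (\<integral>\<^sup>+t. ennreal (B * (indicator {-r..r} t + norm (f t) ^ 4)) \<partial>lborel) * ennreal (2 * r * (2 * r))"
          by (simp add: nn_integral_cmult nn_integral_multc eQ)
        also have "\<dots> < \<infinity>"
          using floc B0 by (subst nn_integral_eq_integral) (auto simp: ennreal_mult_less_top)
        finally show "(\<integral>\<^sup>+x. ennreal (norm (case_prod ?h x)) \<partial>(lborel \<Otimes>\<^sub>M ?P)) < \<infinity>" .
      qed measurable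
      have "T z = (\<integral>t. \<integral>p. ?h t p \<partial>?P \<partial>lborel)"
        unfolding T_def
      proof (rule Bochner_Integration.integral_cong[OF refl])
        fix t
        have "(\<integral>p. ?h t p \<partial>?P) = (\<integral>p. (?i p *\<^sub>R D (fst p, snd p, t)) * (f t * osc lam z t) \<partial>?P)"
          by (simp add: g_def mult_ac)
        also have "\<dots> = (\<integral>p. ?i p *\<^sub>R D (fst p, snd p, t) \<partial>?P) * (f t * osc lam z t)"
          by (rule integral_mult_left_zero)
        also have "\<dots> = \<psi> (fst z, snd z, t) * (f t * osc lam z t)" unfolding \<psi>D ..
        finally show "osc lam z t * \<psi> (fst z, snd z, t) * f t = (\<integral>p. ?h t p \<partial>?P)" by (simp add: mult_ac)
      qed
      also have "\<dots> = (\<integral>p. \<integral>t. ?h t p \<partial>lborel \<partial>?P)"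
        by (rule pair_sigma_finite.Fubini_integral[OF PS hint, symmetric])
      also have "\<dots> = (\<integral>p. ?i p *\<^sub>R S p z \<partial>?P)"
        unfolding S_def integral_scaleR_right ..
      finally show ?thesis .
    qed
    have Tbound: "ennreal (norm (T z)) \<le> (\<integral>\<^sup>+p. indicator Q p * ennreal (norm (S p z)) \<partial>?P)" for z
    proof -
      have "ennreal (norm (T z)) \<le> (\<integral>\<^sup>+p. ennreal (norm ((indicator {..fst z} (fst p) * indicator {..snd z} (snd p)) *\<^sub>R S p z)) \<partial>?P)"
        unfolding TS
        by (rule norm_integral_le_nn_integral)
      also have "\<dots> \<le> (\<integral>\<^sup>+p. indicator Q p * ennreal (norm (S p z)) \<partial>?P)"
      proof (intro nn_integral_mono)
        fix p
        have "S p z = 0" if "p \<notin> Q" using gQ[OF that] by (simp add: S_def)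
        then show "ennreal (norm ((indicator {..fst z} (fst p) * indicator {..snd z} (snd p)) *\<^sub>R S p z)) \<le> indicator Q p * ennreal (norm (S p z))"
          by (cases "p \<in> Q") (auto simp: indicator_def)
      qed
      finally show ?thesis .
    qed
    have T4: "ennreal (norm (T z) ^ 4) \<le> ennreal ((2 * r * (2 * r)) ^ 3) * (\<integral>\<^sup>+p. indicator Q p * ennreal (norm (S p z) ^ 4) \<partial>?P)" for z
    proof -
      have "ennreal (norm (T z) ^ 4) = ennreal (norm (T z)) ^ 4" by (simp add: ennreal_power)
      also have "\<dots> \<le> (\<integral>\<^sup>+p. indicator Q p * ennreal (norm (S p z)) \<partial>?P) ^ 4"
        by (intro power_mono Tbound) auto
      also have "\<dots> \<le> emeasure ?P Q ^ 3 * (\<integral>\<^sup>+p. indicator Q p * ennreal (norm (S p z)) ^ 4 \<partial>?P)"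
        by (rule nn_integral_power4_le) measurable
      finally show ?thesis using r by (simp add: eQ ennreal_power)
    qed
    have S4: "(\<integral>\<^sup>+z. ennreal (norm (S p z) ^ 4) \<partial>gauss2) \<le> ennreal (C * B ^ 4 * lam powr (-3/2)) * N" for p
    proof -
      have "(\<integral>\<^sup>+z. ennreal (norm (S p z) ^ 4) \<partial>gauss2) \<le> ennreal (C * lam powr (-3/2)) * (\<integral>\<^sup>+t. ennreal (norm (g p t) ^ 4) \<partial>lborel)"
        unfolding S_def using ext lam gint g0 by blast
      also have "\<dots> \<le> ennreal (C * lam powr (-3/2)) * (\<integral>\<^sup>+t. ennreal (B ^ 4) * ennreal (norm (f t) ^ 4) \<partial>lborel)"
        by (intro mult_left_mono nn_integral_mono)
           (auto simp: g_def norm_mult power_mult_distrib B B0 simp flip: ennreal_mult intro!: ennreal_leI mult_right_mono power_mono)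
      also have "\<dots> = ennreal (C * lam powr (-3/2)) * (ennreal (B ^ 4) * N)"
        unfolding N_def by (simp add: nn_integral_cmult)
      also have "\<dots> = ennreal (C * B ^ 4 * lam powr (-3/2)) * N"
      proof -
        have "ennreal (C * B ^ 4 * lam powr (-3/2)) = ennreal (C * lam powr (-3/2)) * ennreal (B ^ 4)"
          using C B0 by (simp add: mult_ac flip: ennreal_mult)
        then show ?thesis by (simp add: mult.assoc)
      qed
      finally show ?thesis .
    qed
    \<comment> \<open>The indicators have been dropped from the bound for \<open>T\<close>, so the
      localization in (x, y) must be read off from \<psi> itself.\<close>
    have T0: "T z = 0" if "\<not> (\<bar>fst z\<bar> \<le> r \<and> \<bar>snd z\<bar> \<le> r)" for z
    proof -
      have "\<psi> (fst z, snd z, t) = 0" for t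
        using that \<psi>0[OF nx] \<psi>0[OF ny] by (auto simp: not_le)
      then show ?thesis by (simp add: T_def)
    qed
    have [measurable]: "T \<in> borel_measurable ?P"
      unfolding T_def by measurable
    have "(\<integral>\<^sup>+z. ennreal (norm (T z) ^ 4) \<partial>?P) \<le> ennreal (2 * pi * exp (r\<^sup>2)) * (\<integral>\<^sup>+z. ennreal (norm (T z) ^ 4) \<partial>gauss2)"
      by (rule nn_integral_lborel_le_gauss2) (auto simp: T0)
    also have "(\<integral>\<^sup>+z. ennreal (norm (T z) ^ 4) \<partial>gauss2)
       \<le> (\<integral>\<^sup>+z. ennreal ((2 * r * (2 * r)) ^ 3) * (\<integral>\<^sup>+p. indicator Q p * ennreal (norm (S p z) ^ 4) \<partial>?P) \<partial>gauss2)"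
      by (intro nn_integral_mono T4)
    also have "\<dots> = ennreal ((2 * r * (2 * r)) ^ 3) * (\<integral>\<^sup>+z. \<integral>\<^sup>+p. indicator Q p * ennreal (norm (S p z) ^ 4) \<partial>?P \<partial>gauss2)"
      by (intro nn_integral_cmult) measurable
    also have "(\<integral>\<^sup>+z. \<integral>\<^sup>+p. indicator Q p * ennreal (norm (S p z) ^ 4) \<partial>?P \<partial>gauss2) = (\<integral>\<^sup>+p. \<integral>\<^sup>+z. indicator Q p * ennreal (norm (S p z) ^ 4) \<partial>gauss2 \<partial>?P)"
      by (intro PG.Fubini') measurable
    also have "\<dots> = (\<integral>\<^sup>+p. indicator Q p * (\<integral>\<^sup>+z. ennreal (norm (S p z) ^ 4) \<partial>gauss2) \<partial>?P)"
      by (simp add: nn_integral_cmult)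
    also have "\<dots> \<le> (\<integral>\<^sup>+p. indicator Q p * (ennreal (C * B ^ 4 * lam powr (-3/2)) * N) \<partial>?P)"
      by (intro nn_integral_mono mult_left_mono S4) auto
    also have "\<dots> = ennreal (2 * r * (2 * r)) * (ennreal (C * B ^ 4 * lam powr (-3/2)) * N)"
      by (simp add: nn_integral_multc eQ)
    finally have "(\<integral>\<^sup>+z. ennreal (norm (T z) ^ 4) \<partial>?P) \<le> ennreal (2 * pi * exp (r\<^sup>2)) * (ennreal ((2 * r * (2 * r)) ^ 3) *
        (ennreal (2 * r * (2 * r)) * (ennreal (C * B ^ 4 * lam powr (-3/2)) * N)))"
      by (simp add: mult_left_mono)
    also have "\<dots> = ennreal (K * lam powr (-3/2)) * N"
    proof -
      have "ennreal (K * lam powr (-3/2)) = ennreal (2 * pi * exp (r\<^sup>2)) * (ennreal ((2 * r * (2 * r)) ^ 3) *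
        (ennreal (2 * r * (2 * r)) * ennreal (C * B ^ 4 * lam powr (-3/2))))"
        unfolding K_def using C B0 r by (simp add: mult_ac flip: ennreal_mult)
      then show ?thesis by (simp add: mult.assoc)
    qed
    finally show ?thesis unfolding T_def N_def .
  qed
  then show ?thesis using C r by (intro exI[of _ K] conjI allI ballI impI) (auto simp: K_def)
qed

section \<open>Lebesgue measurable inputs and the norm inequality\<close>

lemma lebesgue_measurable_complex_borel_representative:
  fixes f :: "'a::euclidean_space \<Rightarrow> complex"
  assumes f: "f \<in> borel_measurable lebesgue"
  obtains g where "g \<in> borel_measurable borel" "AE x in lebesgue. f x = g x"
proof -
  have "(\<lambda>x. Re (f x)) \<in> borel_measurable lebesgue" "(\<lambda>x. Im (f x)) \<in> borel_measurable lebesgue"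
    using f by measurable
  from this[THEN completion_ex_borel_measurable_real]
  obtain a b where a: "a \<in> borel_measurable lborel" "AE x in lborel. Re (f x) = a x"
    and b: "b \<in> borel_measurable lborel" "AE x in lborel. Im (f x) = b x"
    by blast
  have [measurable]: "a \<in> borel_measurable borel" "b \<in> borel_measurable borel" using a(1) b(1) by simp_all
  show ?thesis
  proof (rule that[of "\<lambda>x. complex_of_real (a x) + \<i> * complex_of_real (b x)"])
    have "AE x in lborel. f x = complex_of_real (a x) + \<i> * complex_of_real (b x)"
      using a(2) b(2) by eventually_elim (simp add: complex_eq_iff)
    then show "AE x in lebesgue. f x = complex_of_real (a x) + \<i> * complex_of_real (b x)"
      by (rule AE_completion)
  qed measurable
qed

text \<open>The value of the operator at every point depends only on the class of \<open>f\<close>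
  modulo null sets, so a Borel representative can be used. Taking fourth roots turns lam powr (-3/2)
  into the decay of order 3/8.\<close>

lemma T_op_bounded:
  fixes \<psi> :: "real \<times> real \<times> real \<Rightarrow> complex"
  assumes \<psi>: "smooth \<psi>" "compactly_supported \<psi>"
  shows "\<exists>C. \<forall>lam>0. \<forall>f \<in> Lp_space 4. Lp_norm_le 4 (T_op lam \<psi> f) (C * lam powr (- (3/8)) * Lp_norm 4 f)"
proof -
  obtain C where C: "C \<ge> 0" and est: "\<forall>lam>0. \<forall>f\<in>borel_measurable borel. (\<integral>\<^sup>+t. ennreal (norm (f t) ^ 4) \<partial>lborel) < \<infinity> \<longrightarrow>
     (\<integral>\<^sup>+z. ennreal (norm (\<integral>t. osc lam z t * \<psi> (fst z, snd z, t) * f t \<partial>lborel) ^ 4) \<partial>(lborel \<Otimes>\<^sub>M lborel))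
       \<le> ennreal (C * lam powr (-3/2)) * (\<integral>\<^sup>+t. ennreal (norm (f t) ^ 4) \<partial>lborel)"
    using oscillatory_operator_L4_estimate[OF \<psi>] by blast
  have [measurable]: "\<psi> \<in> borel_measurable borel"
    using \<psi>(1) C_k_continuous unfolding smooth_def by (blast intro: borel_measurable_continuous_onI)
  have "Lp_norm_le 4 (T_op lam \<psi> f) (C powr (1/4) * lam powr (- (3/8)) * Lp_norm 4 f)"
    if lam: "lam > 0" and f: "f \<in> Lp_space 4" for lam f
  proof -
    have fm [measurable]: "f \<in> borel_measurable lebesgue" and fi: "integrable lebesgue (\<lambda>x. norm (f x) powr 4)"
      using f unfolding Lp_space_def by auto
    obtain g where [measurable]: "g \<in> borel_measurable borel" and fg: "AE x in lebesgue. f x = g x"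
      using lebesgue_measurable_complex_borel_representative[OF fm] by blast
    define I where "I = (\<integral>x. norm (f x) powr 4 \<partial>lebesgue)"
    have I0: "I \<ge> 0" unfolding I_def by (intro integral_nonneg_AE) auto
    have gI: "(\<integral>\<^sup>+t. ennreal (norm (g t) ^ 4) \<partial>lborel) = ennreal I"
    proof -
      have "(\<integral>\<^sup>+t. ennreal (norm (g t) ^ 4) \<partial>lborel) = (\<integral>\<^sup>+t. ennreal (norm (g t) ^ 4) \<partial>lebesgue)"
        by (simp add: nn_integral_completion)
      also have "\<dots> = (\<integral>\<^sup>+t. ennreal (norm (f t) powr 4) \<partial>lebesgue)"
        using fg by (intro nn_integral_cong_AE) (auto simp: powr_numeral)
      also have "\<dots> = ennreal I"
        unfolding I_def using fi by (intro nn_integral_eq_integral) auto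
      finally show ?thesis .
    qed
    have T: "T_op lam \<psi> f z = (\<integral>t. osc lam z t * \<psi> (fst z, snd z, t) * g t \<partial>lborel)" for z
    proof -
      have [measurable]: "(\<lambda>t. osc lam z t * \<psi> (fst z, snd z, t)) \<in> borel_measurable lebesgue"
        by (intro measurable_completion) simp
      have [measurable]: "g \<in> borel_measurable lebesgue" by (intro measurable_completion) simp
      have "T_op lam \<psi> f z = (\<integral>t. osc lam z t * \<psi> (fst z, snd z, t) * f t \<partial>lebesgue)"
        unfolding T_op_def by (simp add: case_prod_beta)
      also have "\<dots> = (\<integral>t. osc lam z t * \<psi> (fst z, snd z, t) * g t \<partial>lebesgue)"
        using fg by (intro integral_cong_AE) (measurable, auto)
      also have "\<dots> = (\<integral>t. osc lam z t * \<psi> (fst z, snd z, t) * g t \<partial>lborel)"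
        by (rule integral_completion) measurable
      finally show ?thesis .
    qed
    have Tm: "T_op lam \<psi> f \<in> borel_measurable (lborel \<Otimes>\<^sub>M lborel)"
      unfolding T[abs_def] by measurable
    then have Tb: "T_op lam \<psi> f \<in> borel_measurable lborel"
      by (simp add: lborel_prod)
    then have Tl: "T_op lam \<psi> f \<in> borel_measurable lebesgue" by (rule measurable_completion)
    have le: "(\<integral>\<^sup>+z. ennreal (norm (T_op lam \<psi> f z) powr 4) \<partial>lebesgue) \<le> ennreal (C * lam powr (-3/2) * I)"
    proof -
      have "(\<integral>\<^sup>+z. ennreal (norm (T_op lam \<psi> f z) powr 4) \<partial>lebesgue) = (\<integral>\<^sup>+z. ennreal (norm (T_op lam \<psi> f z) ^ 4) \<partial>(lborel \<Otimes>\<^sub>M lborel))"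
        by (simp add: nn_integral_completion lborel_prod powr_numeral)
      also have "\<dots> \<le> ennreal (C * lam powr (-3/2)) * ennreal I"
        unfolding T gI[symmetric] using lam gI by (intro est[rule_format]) auto
      finally show ?thesis using C I0 by (simp flip: ennreal_mult)
    qed
    have int: "integrable lebesgue (\<lambda>z. norm (T_op lam \<psi> f z) powr 4)"
      using Tl le by (intro integrableI_bounded) (auto intro: le_less_trans)
    have "ennreal (\<integral>z. norm (T_op lam \<psi> f z) powr 4 \<partial>lebesgue) \<le> ennreal (C * lam powr (-3/2) * I)"
      using le by (subst (asm) nn_integral_eq_integral[OF int]) auto
    then have le': "(\<integral>z. norm (T_op lam \<psi> f z) powr 4 \<partial>lebesgue) \<le> C * lam powr (-3/2) * I"
      using C I0 by (subst (asm) ennreal_le_iff) auto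
    have "Lp_norm 4 (T_op lam \<psi> f) \<le> (C * lam powr (-3/2) * I) powr (1/4)"
      unfolding Lp_norm_def by (intro powr_mono2 le' integral_nonneg_AE) auto
    also have "\<dots> = C powr (1/4) * lam powr (- (3/8)) * Lp_norm 4 f"
      using C I0 lam by (simp add: powr_mult powr_powr Lp_norm_def I_def)
    finally show ?thesis using Tl int unfolding Lp_norm_le_def Lp_space_def by auto
  qed
  then show ?thesis by blast
qed

section \<open>Sharpness\<close>

text \<open>The classical flat function is the case n = 0. The negative powers are included because
  the derivative of each member is a linear combination of members.\<close>

definition flat :: "nat \<Rightarrow> real \<Rightarrow> real" where
  "flat n s = (if s > 0 then exp (- 1 / s) / s ^ n else 0)"

text \<open>A single term of the exponential series, (1/s)^(n+1) / (n+1)!, is at most exp (1/s). One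
  power of \<open>s\<close> more than boundedness is kept to control difference quotients at
  0.\<close>

lemma flat_le: "\<bar>flat n s\<bar> \<le> fact (Suc n) * \<bar>s\<bar>"
proof (cases "s > 0")
  case True
  have "(\<Sum>k<Suc (Suc n). (1/s) ^ k /\<^sub>R fact k) \<le> exp (1/s)"
    unfolding exp_def by (rule sum_le_suminf[OF summable_exp_generic]) (use True in auto)
  moreover have "(1/s) ^ Suc n /\<^sub>R fact (Suc n) \<le> (\<Sum>k<Suc (Suc n). (1/s) ^ k /\<^sub>R fact k)"
    by (rule member_le_sum) (use True in auto)
  ultimately have *: "(1/s) ^ Suc n /\<^sub>R fact (Suc n) \<le> exp (1/s)" by linarith
  define F :: real where "F = fact (Suc n)"
  have F: "F > 0" unfolding F_def by simp
  have "1 / (s * s ^ n * F) \<le> exp (1/s)"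
    using * unfolding F_def[symmetric] by (simp add: power_inverse divide_inverse mult_ac)
  then have "1 \<le> F * s * s ^ n * exp (1/s)"
    using True F by (simp add: field_simps)
  then have "exp (- 1 / s) / s ^ n \<le> F * s"
    using True by (simp add: exp_minus field_simps)
  then show ?thesis using True by (simp add: flat_def F_def del: fact_Suc)
qed (simp add: flat_def mult_le_0_iff del: fact_Suc)

text \<open>Away from 0 this is calculus on an open half-line. At 0 the difference quotient is again
  a member of the family, with index raised by one, hence bounded by a multiple of |h|.\<close>

lemma DERIV_flat: "(flat n has_real_derivative (flat (n + 2) s - n * flat (n + 1) s)) (at s)"
proof -
  consider "s > 0" | "s < 0" | "s = 0" by linarith
  then show ?thesis
  proof cases
    case 1
    have "((\<lambda>s. exp (- 1 / s) / s ^ n) has_real_derivative (flat (n + 2) s - n * flat (n + 1) s)) (at s)"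
    proof -
      have "((\<lambda>s. exp (- 1 / s) / s ^ n) has_real_derivative
          (exp (- 1 / s) * (1 / s\<^sup>2) * s ^ n - exp (- 1 / s) * (n * s ^ (n - 1))) / (s ^ n * s ^ n)) (at s)"
        using 1 by (auto intro!: derivative_eq_intros simp: power2_eq_square)
      also have "(exp (- 1 / s) * (1 / s\<^sup>2) * s ^ n - exp (- 1 / s) * (n * s ^ (n - 1))) / (s ^ n * s ^ n)
          = flat (n + 2) s - n * flat (n + 1) s"
        using 1 by (cases n) (simp_all add: flat_def field_simps power2_eq_square)
      finally show ?thesis .
    qed
    then show ?thesis
      by (rule has_field_derivative_transform_within_open[where S = "{0<..}"]) (use 1 in \<open>auto simp: flat_def\<close>)
  next
    case 2
    have "((\<lambda>s. 0) has_real_derivative (flat (n + 2) s - n * flat (n + 1) s)) (at s)"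
      using 2 by (simp add: flat_def)
    then show ?thesis
      by (rule has_field_derivative_transform_within_open[where S = "{..<0}"]) (use 2 in \<open>auto simp: flat_def\<close>)
  next
    case 3
    have "((\<lambda>h. flat n h / h) \<longlongrightarrow> 0) (at 0)"
    proof (rule Lim_null_comparison)
      have "norm (flat n h / h) \<le> fact (Suc (Suc n)) * \<bar>h\<bar>" for h
        using flat_le[of "Suc n" h] by (cases "h > 0") (auto simp: flat_def field_simps)
      then show "\<forall>\<^sub>F h in at 0. norm (flat n h / h) \<le> fact (Suc (Suc n)) * \<bar>h\<bar>" by simp
      show "((\<lambda>h. fact (Suc (Suc n)) * \<bar>h\<bar>) \<longlongrightarrow> 0) (at (0::real))"
        by (intro tendsto_mult_right_zero tendsto_rabs_zero tendsto_ident_at)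
    qed
    then show ?thesis unfolding 3 by (simp add: DERIV_def flat_def)
  qed
qed

text \<open>An algebra containing the bump and closed under all directional derivatives, so that
  \<open>C_k\<close> for every k follows by one induction. The generators \<open>inner\<close> and
  \<open>const\<close> are what the chain rule for \<open>4 - z \<bullet> z\<close>
  produces.\<close>

inductive bump_algebra :: "('a::euclidean_space \<Rightarrow> real) \<Rightarrow> bool" where
  const: "bump_algebra (\<lambda>z. c)"
| inner: "bump_algebra (\<lambda>z. z \<bullet> v)"
| flat: "bump_algebra (\<lambda>z. flat n (4 - z \<bullet> z))"
| add: "bump_algebra f \<Longrightarrow> bump_algebra g \<Longrightarrow> bump_algebra (\<lambda>z. f z + g z)"
| mult: "bump_algebra f \<Longrightarrow> bump_algebra g \<Longrightarrow> bump_algebra (\<lambda>z. f z * g z)"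

lemma bump_algebra_derivative:
  "bump_algebra f \<Longrightarrow> \<exists>f'. (\<forall>z. (f has_derivative f' z) (at z)) \<and> (\<forall>v. bump_algebra (\<lambda>z. f' z v))"
proof (induction rule: bump_algebra.induct)
  case (const c)
  show ?case by (rule exI[of _ "\<lambda>z v. 0"]) (auto intro: bump_algebra.const)
next
  case (inner v)
  show ?case
    by (rule exI[of _ "\<lambda>z w. w \<bullet> v"]) (auto intro: bump_algebra.const intro!: derivative_eq_intros)
next
  case (flat n)
  \<comment> \<open>Written with sums and products only, so that the introduction rules of
    \<open>bump_algebra\<close> match it.\<close>
  let ?d = "\<lambda>z w. (flat (n + 2) (4 - z \<bullet> z) + (- real n) * flat (n + 1) (4 - z \<bullet> z)) * ((- 2) * (z \<bullet> w))"
  have 1: "((\<lambda>z. flat n (4 - z \<bullet> z)) has_derivative ?d z) (at z)" for z :: 'a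
  proof -
    have "((\<lambda>z. 4 - z \<bullet> z) has_derivative (\<lambda>w. (- 2) * (z \<bullet> w))) (at z)"
      by (auto intro!: derivative_eq_intros simp: inner_commute)
    moreover have "(flat n has_derivative (\<lambda>h. (flat (n + 2) (4 - z \<bullet> z) + (- real n) * flat (n + 1) (4 - z \<bullet> z)) * h)) (at (4 - z \<bullet> z))"
      using DERIV_flat[of n "4 - z \<bullet> z"] unfolding has_field_derivative_def by simp
    ultimately show ?thesis by (rule has_derivative_compose)
  qed
  have 2: "bump_algebra (\<lambda>z. ?d z w)" for w :: 'a
    by (intro bump_algebra.intros)
  show ?case using 1 2 by (intro exI[of _ ?d] conjI allI)
next
  case (add f g)
  then obtain f' g' where "\<forall>z. (f has_derivative f' z) (at z)" "\<forall>v. bump_algebra (\<lambda>z. f' z v)"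
    "\<forall>z. (g has_derivative g' z) (at z)" "\<forall>v. bump_algebra (\<lambda>z. g' z v)" by blast
  then show ?case
    by (intro exI[of _ "\<lambda>z v. f' z v + g' z v"]) (auto intro: has_derivative_add bump_algebra.add)
next
  case (mult f g)
  then obtain f' g' where "\<forall>z. (f has_derivative f' z) (at z)" "\<forall>v. bump_algebra (\<lambda>z. f' z v)"
    "\<forall>z. (g has_derivative g' z) (at z)" "\<forall>v. bump_algebra (\<lambda>z. g' z v)" by blast
  then show ?case using mult.hyps
    by (intro exI[of _ "\<lambda>z v. f z * g' z v + f' z v * g z"] conjI allI has_derivative_mult
          bump_algebra.add bump_algebra.mult) blast+
qed

lemma C_k_bump_algebra: "bump_algebra f \<Longrightarrow> C_k k (\<lambda>z. complex_of_real (f z))"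
proof (induction k arbitrary: f)
  case 0
  obtain f' where "\<forall>z. (f has_derivative f' z) (at z)" using bump_algebra_derivative[OF 0] by blast
  then have "continuous_on UNIV f" by (meson continuous_at_imp_continuous_on has_derivative_continuous)
  then show ?case by (simp add: continuous_on_of_real)
next
  case (Suc k)
  obtain f' where f': "\<forall>z. (f has_derivative f' z) (at z)" "\<forall>v. bump_algebra (\<lambda>z. f' z v)"
    using bump_algebra_derivative[OF Suc.prems] by blast
  have d: "((\<lambda>z. complex_of_real (f z)) has_derivative (\<lambda>v. complex_of_real (f' z v))) (at z)" for z
    using f'(1) by (auto intro: has_derivative_of_real)
  have "frechet_derivative (\<lambda>z. complex_of_real (f z)) (at z) = (\<lambda>v. complex_of_real (f' z v))" for z
    using frechet_derivative_at[OF d] by simp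
  then show ?case using d Suc.IH f'(2) by (auto simp: differentiable_def)
qed

lemma smooth_bump: "smooth (\<lambda>z. complex_of_real (flat 0 (4 - z \<bullet> z)))"
  unfolding smooth_def by (intro allI C_k_bump_algebra bump_algebra.flat)

lemma compactly_supported_bump:
  "compactly_supported (\<lambda>z::'a::euclidean_space. complex_of_real (flat 0 (4 - z \<bullet> z)))"
proof -
  have "norm z \<le> 2" if "flat 0 (4 - z \<bullet> z) \<noteq> 0" for z :: 'a
  proof -
    have "(norm z)\<^sup>2 \<le> 2\<^sup>2" using that by (auto simp: flat_def dot_square_norm split: if_splits)
    then show ?thesis by (rule power2_le_imp_le) simp
  qed
  then have "{z::'a. complex_of_real (flat 0 (4 - z \<bullet> z)) \<noteq> 0} \<subseteq> cball 0 2" by auto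
  then show ?thesis unfolding compactly_supported_def
    using bounded_subset[OF bounded_cball] by (simp add: compact_closure)
qed

text \<open>In this range of (x, y) the phase stays within [-1, 1] for all t in [0, 1], so its
  cosine is at least 1/2, and the bump is at least exp (-1). The real part of the integrand is thus
  bounded below on the whole unit interval.\<close>

lemma norm_T_op_bump_lower_bound:
  assumes lam: "lam \<ge> 1" and x: "\<bar>x\<bar> \<le> lam powr (-1/2) / 2" and y: "\<bar>y\<bar> \<le> lam powr (-1) / 2"
  shows "exp (-1) / 2 \<le> norm (T_op lam (\<lambda>z. complex_of_real (flat 0 (4 - z \<bullet> z))) (indicator {0..1}) (x, y))"
proof -
  define b where "b t = flat 0 (4 - (x, y, t) \<bullet> (x, y, t))" for t :: real
  define ph where "ph t = lam * (x\<^sup>2 * t + y * t\<^sup>2)" for t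
  define h where "h t = iexp (ph t) * complex_of_real (b t) * indicator {0..1} t" for t
  have b1: "\<bar>b t\<bar> \<le> 1" for t by (auto simp: b_def flat_def)
  have "continuous_on UNIV (\<lambda>z::real\<times>real\<times>real. complex_of_real (flat 0 (4 - z \<bullet> z)))"
    using C_k_bump_algebra[OF bump_algebra.flat, of 0] by simp
  then have "(\<lambda>t. complex_of_real (b t)) \<in> borel_measurable borel"
    unfolding b_def
    by (intro borel_measurable_continuous_onI) (rule continuous_on_compose2[of UNIV]; auto intro!: continuous_intros)
  from borel_measurable_Re[THEN measurable_compose[OF this]]
  have [measurable]: "b \<in> borel_measurable borel" by simp
  have [measurable]: "h \<in> borel_measurable borel" unfolding h_def ph_def by measurable
  have i01: "integrable lborel (indicator {0..1::real} :: real \<Rightarrow> real)" by (rule integrable_real_indicator) auto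
  have hint: "integrable lborel h"
    by (rule Bochner_Integration.integrable_bound[OF i01]) (auto simp: h_def norm_mult b1 indicator_def)
  have T: "T_op lam (\<lambda>z. complex_of_real (flat 0 (4 - z \<bullet> z))) (indicator {0..1}) (x, y) = (\<integral>t. h t \<partial>lborel)"
  proof -
    have "(\<integral>t. h t \<partial>lebesgue) = (\<integral>t. h t \<partial>lborel)" by (rule integral_completion) simp
    then show ?thesis unfolding T_op_def h_def ph_def b_def prod.case .
  qed
  have low: "exp (-1) / 2 * indicator {0..1} t \<le> Re (h t)" for t
  proof (cases "t \<in> {0..1}")
    case True
    have a1: "lam powr (-1) \<le> 1" using powr_mono[of "-1" 0 lam] lam by simp
    have x2: "x\<^sup>2 \<le> (lam powr (-1/2) / 2)\<^sup>2" using x by (simp add: abs_le_square_iff[symmetric])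
    also have "\<dots> = lam powr (-1) / 4" using lam by (simp add: power_divide powr_power)
    finally have x2: "x\<^sup>2 \<le> lam powr (-1) / 4" .
    have t2: "t\<^sup>2 \<le> 1" "0 \<le> t" "t \<le> 1" using True by (auto simp: power_le_one)
    have "\<bar>x\<^sup>2 * t + y * t\<^sup>2\<bar> \<le> x\<^sup>2 * t + \<bar>y\<bar> * t\<^sup>2"
      using t2 by (auto simp: abs_mult intro!: order_trans[OF abs_triangle_ineq])
    also have "\<dots> \<le> lam powr (-1) / 4 * 1 + lam powr (-1) / 2 * 1"
      by (intro add_mono mult_mono x2 y) (use t2 in auto)
    \<comment> \<open>The two terms add up to three quarters of the right-hand side.\<close>
    also have "\<dots> \<le> lam powr (-1)" using powr_ge_zero[of lam "-1"] by linarith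
    finally have "\<bar>ph t\<bar> \<le> lam * lam powr (-1)"
      unfolding ph_def abs_mult using lam by (intro mult_mono) auto
    also have "\<dots> = 1" using lam by (simp add: powr_minus)
    finally have ph: "\<bar>ph t\<bar> \<le> 1" .
    \<comment> \<open>The bound 1 on the phase is below pi / 3.\<close>
    have "cos (pi / 3) \<le> cos \<bar>ph t\<bar>"
      by (rule cos_monotone_0_pi_le) (use ph pi_gt3 in auto)
    then have c: "1 / 2 \<le> cos (ph t)" by (simp add: cos_60)
    have "y\<^sup>2 \<le> 1"
      using y a1 by (simp add: abs_le_square_iff[symmetric, of y 1, simplified])
    moreover have "x\<^sup>2 \<le> 1" using x2 a1 by simp
    \<comment> \<open>Each of the three squares is at most 1. The 4 in the bump leaves a margin of
      1, at which \<open>flat 0\<close> equals exp (-1).\<close>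
    ultimately have "1 \<le> 4 - (x, y, t) \<bullet> (x, y, t)" using t2 by (simp add: power2_eq_square)
    then have "exp (-1) \<le> b t" unfolding b_def flat_def by (simp add: field_simps)
    then have "1 / 2 * exp (-1) \<le> cos (ph t) * b t" using c by (intro mult_mono) auto
    then show ?thesis using True by (simp add: h_def Re_exp)
  qed (simp add: h_def)
  have "exp (-1) / 2 = (\<integral>t. exp (-1) / 2 * indicator {0..1::real} t \<partial>lborel :: real)" by simp
  also have "\<dots> \<le> (\<integral>t. Re (h t) \<partial>lborel)"
    using hint i01 by (intro integral_mono low integrable_mult_right) auto
  also have "\<dots> = Re (\<integral>t. h t \<partial>lborel)" using hint by (rule integral_Re)
  also have "\<dots> \<le> norm (\<integral>t. h t \<partial>lborel)" by (rule complex_Re_le_cmod)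
  finally show ?thesis unfolding T .
qed

lemma Lp_norm_indicator_unit_interval:
  "(indicator {0..1} :: real \<Rightarrow> complex) \<in> Lp_space 4"
  "Lp_norm 4 (indicator {0..1} :: real \<Rightarrow> complex) = 1"
proof -
  have i: "norm (indicator {0..1} x :: complex) powr 4 = indicator {0..1} x" for x :: real
    by (auto simp: indicator_def)
  have m: "(indicator {0..1::real} :: real \<Rightarrow> complex) \<in> borel_measurable lebesgue"
    by (intro measurable_completion) simp
  show "(indicator {0..1} :: real \<Rightarrow> complex) \<in> Lp_space 4"
    unfolding Lp_space_def mem_Collect_eq i by (intro conjI m integrable_real_indicator) auto
  show "Lp_norm 4 (indicator {0..1} :: real \<Rightarrow> complex) = 1"
    unfolding Lp_norm_def i by simp
qed

text \<open>The pointwise lower bound makes the norm at least a constant times lam powr (-3/8). If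
  \<delta> exceeded 3/8 by e > 0, the assumed estimate would bound lam powr e for all lam \<ge>
  1.\<close>

lemma T_op_decay_exponent_le:
  assumes "\<forall>lam\<ge>1. \<forall>f \<in> Lp_space 4.
    Lp_norm_le 4 (T_op lam (\<lambda>z. complex_of_real (flat 0 (4 - z \<bullet> z))) f) (C * lam powr (- \<delta>) * Lp_norm 4 f)"
  shows "\<delta> \<le> 3/8"
proof (rule ccontr)
  assume "\<not> \<delta> \<le> 3/8"
  define e where "e = \<delta> - 3/8"
  have e: "e > 0" using \<open>\<not> \<delta> \<le> 3/8\<close> by (simp add: e_def)
  define c :: real where "c = exp (-1) / 2"
  have c: "c > 0" by (simp add: c_def)
  let ?T = "\<lambda>lam. T_op lam (\<lambda>z. complex_of_real (flat 0 (4 - z \<bullet> z))) (indicator {0..1})"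
  have key: "c * lam powr e \<le> C" if lam: "lam \<ge> 1" for lam
  proof -
    have T: "Lp_norm_le 4 (?T lam) (C * lam powr (- \<delta>))"
      using assms[rule_format, OF lam Lp_norm_indicator_unit_interval(1)]
      unfolding Lp_norm_indicator_unit_interval(2) by simp
    then have int: "integrable lebesgue (\<lambda>z. norm (?T lam z) powr 4)"
      and le: "Lp_norm 4 (?T lam) \<le> C * lam powr (- \<delta>)"
      unfolding Lp_norm_le_def Lp_space_def by auto
    define a where "a = lam powr (-1/2) / 2"
    define d where "d = lam powr (-1) / 2"
    have ad: "a \<ge> 0" "d \<ge> 0" by (auto simp: a_def d_def)
    \<comment> \<open>The halves in \<open>a\<close> and \<open>d\<close> make the measure of
      \<open>A\<close> exactly lam powr (-3/2).\<close>
    define A where "A = {-a..a} \<times> {-d..d}"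
    have "emeasure lborel A = ennreal (2 * a * (2 * d))"
      unfolding A_def lborel_prod[symmetric] using ad
      by (subst lborel.emeasure_pair_measure_Times) (auto simp flip: ennreal_mult)
    moreover have As: "A \<in> sets borel" unfolding A_def by (intro borel_closed closed_Times) auto
    ultimately have eA: "emeasure lebesgue A = ennreal (2 * a * (2 * d))" and As': "A \<in> sets lebesgue" by auto
    have "c ^ 4 * (2 * a * (2 * d)) = (\<integral>z. c ^ 4 * indicator A z \<partial>lebesgue)"
      using ad eA As' by (simp add: measure_def)
    also have "\<dots> \<le> (\<integral>z. norm (?T lam z) powr 4 \<partial>lebesgue)"
    proof (intro integral_mono int)
      show "integrable lebesgue (\<lambda>z. c ^ 4 * indicator A z)"
        by (intro integrable_mult_right integrable_real_indicator As') (simp add: eA)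
      show "c ^ 4 * indicator A z \<le> norm (?T lam z) powr 4" for z
      proof (cases "z \<in> A")
        case True
        then have "c \<le> norm (?T lam (fst z, snd z))"
          unfolding c_def by (intro norm_T_op_bump_lower_bound lam) (auto simp: A_def a_def d_def)
        then have "c ^ 4 \<le> norm (?T lam z) ^ 4" using c by (intro power_mono) auto
        then show ?thesis using True by simp
      qed simp
    qed
    finally have "(c ^ 4 * (2 * a * (2 * d))) powr (1/4) \<le> Lp_norm 4 (?T lam)"
      unfolding Lp_norm_def by (intro powr_mono2) (use ad c in auto)
    also have "c ^ 4 * (2 * a * (2 * d)) = c powr 4 * lam powr (-3/2)"
      using c powr_add[of lam "-1/2" "-1"] by (simp add: a_def d_def)
    also have "(c powr 4 * lam powr (-3/2)) powr (1/4) = c * lam powr (-3/8)"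
      using c lam by (simp add: powr_mult powr_powr del: powr_numeral)
    finally have "c * lam powr (-3/8) \<le> C * lam powr (- \<delta>)" using le by linarith
    then have "c * lam powr (-3/8) * lam powr \<delta> \<le> C * lam powr (- \<delta>) * lam powr \<delta>"
      by (intro mult_right_mono) auto
    moreover have "lam powr (-3/8) * lam powr \<delta> = lam powr e" "lam powr (- \<delta>) * lam powr \<delta> = 1"
      using lam by (simp_all add: e_def powr_add[symmetric] algebra_simps)
    ultimately show ?thesis by (simp add: mult.assoc)
  qed
  \<comment> \<open>Chosen so that c * lam powr e is at least C + c, hence larger than
    \<open>C\<close>; the maximum keeps lam \<ge> 1 even if \<open>C\<close> is negative.\<close>
  define lam where "lam = max 1 (C / c + 1) powr (1 / e)"
  have "lam \<ge> 1" unfolding lam_def using e by (intro ge_one_powr_ge_zero) auto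
  moreover have "lam powr e = max 1 (C / c + 1)" unfolding lam_def using e by (simp add: powr_powr)
  ultimately have "c * max 1 (C / c + 1) \<le> C" using key[of lam] by simp
  moreover have "c * (C / c + 1) \<le> c * max 1 (C / c + 1)" using c by (intro mult_left_mono) auto
  moreover have "c * (C / c + 1) = C + c" using c by (simp add: field_simps)
  ultimately show False using c by linarith
qed

theorem theorem1p1:
  shows "(\<forall>\<psi> :: real \<times> real \<times> real \<Rightarrow> complex. smooth \<psi> \<and> compactly_supported \<psi> \<longrightarrow>
           (\<exists>C::real. \<forall>lam>0. \<forall>f \<in> Lp_space 4.
              Lp_norm_le 4 (T_op lam \<psi> f) (C * lam powr (- (3/8)) * Lp_norm 4 f))) \<and>
         (\<forall>\<delta>::real.
           (\<forall>\<psi> :: real \<times> real \<times> real \<Rightarrow> complex. smooth \<psi> \<and> compactly_supported \<psi> \<longrightarrow>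
             (\<exists>C::real. \<forall>lam\<ge>1. \<forall>f \<in> Lp_space 4.
                Lp_norm_le 4 (T_op lam \<psi> f) (C * lam powr (- \<delta>) * Lp_norm 4 f)))
           \<longrightarrow> \<delta> \<le> 3/8)"
proof (intro conjI allI impI)
  fix \<psi> :: "real \<times> real \<times> real \<Rightarrow> complex"
  assume "smooth \<psi> \<and> compactly_supported \<psi>"
  then show "\<exists>C. \<forall>lam>0. \<forall>f \<in> Lp_space 4. Lp_norm_le 4 (T_op lam \<psi> f) (C * lam powr (- (3/8)) * Lp_norm 4 f)"
    using T_op_bounded by blast
next
  fix \<delta> :: real
  let ?\<psi> = "\<lambda>z::real \<times> real \<times> real. complex_of_real (flat 0 (4 - z \<bullet> z))"
  assume "\<forall>\<psi> :: real \<times> real \<times> real \<Rightarrow> complex. smooth \<psi> \<and> compactly_supported \<psi> \<longrightarrow>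
    (\<exists>C::real. \<forall>lam\<ge>1. \<forall>f \<in> Lp_space 4. Lp_norm_le 4 (T_op lam \<psi> f) (C * lam powr (- \<delta>) * Lp_norm 4 f))"
  from this[rule_format, of ?\<psi>] obtain C where
    "\<forall>lam\<ge>1. \<forall>f \<in> Lp_space 4. Lp_norm_le 4 (T_op lam ?\<psi> f) (C * lam powr (- \<delta>) * Lp_norm 4 f)"
    using smooth_bump compactly_supported_bump by blast
  then show "\<delta> \<le> 3/8" by (rule T_op_decay_exponent_le)
qed

end
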